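(* Let $G=(V,E)$ be a finite (not necessarily decomposable) graph, let $x\in M_G$, and let $L$ be the free quotient monoid induced by $G$. Let $\ell$ be a random variable valued in $L$ with distribution $$\mathbb P(\ell=[w])=\frac{\pi_w(x)}{\sum_{[w']\in L}\pi_{w'}(x)},\qquad [w]\in L,$$ where $\pi_w(x)=\prod_{i\in w}x_i$ (product over the letters of $w$ with multiplicity). Let $\varepsilon\colon L\to\mathbb N^V$ be the map such that $\varepsilon([w])$ counts the number of occurrences of each letter from $V$ in $[w]$. Then $\varepsilon(\ell)\sim\operatorname{nm}_G(1,x)$, that is, $$\mathbb P(\varepsilon(\ell)=n)=\genfrac{[}{]}{0pt}{}{|n|}{n}_G\,x^n\,\Delta_G(x),\qquad n\in\mathbb N^V.$$
   Context: $\mathbb N=\{0,1,2,\ldots\}$. $G=(V,E)$ is a finite undirected simple graph, $G^*=(V,E^* )$ its complement graph, $G_A$ the subgraph induced by $A\subset V$, $\mathcal C_{G^*}$ the set of cliques (sets of pairwise adjacent vertices, including $\emptyset$ and singletons) of $G^*$. Free quotient monoid: view $V$ as an alphabet and let $\mathfrak V$ be the free monoid of finite words over $V$ (with concatenation). Two words are adjacent if they have the forms $w_1i_1i_2w_2$ and $w_1i_2i_1w_2$ with $w_1,w_2\in\mathfrak V$ and $\{i_1,i_2\}\in E^*$; two words are equivalent if they are joined by a finite sequence of words in which consecutive ones are adjacent. $L=\mathfrak V/\sim$ is the quotient monoid and $[w]$ is the class of $w$. The quantities $\pi_w(x)$ and $\varepsilon([w])$ depend only on $[w]$. $\Delta_G(x)=\sum_{C\in\mathcal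 C_{G^*}}(-1)^{|C|}\prod_{i\in C}x_i$; for $A\subset V$, $\Delta_A(x):=\Delta_{G_A}(x_A)$, where $x_A=(x_i)_{i\in A}$ and $\Delta_\emptyset=1$. $M_G=\{x\in(0,\infty)^V:\Delta_A(x)>0\ \forall A\subset V\}$. $x^n=\prod_{i\in V}x_i^{n_i}$, $|n|=\sum_{i\in V}n_i$. The coefficients $\genfrac{[}{]}{0pt}{}{|n|}{n}_G$ are defined by the formal power series expansion $\Delta_G(x)^{-1}=\sum_{n\in\mathbb N^V}\genfrac{[}{]}{0pt}{}{|n|}{n}_G x^n$. *)

theory Defs
  imports "HOL-Probability.Probability" "HOL-Algebra.Group"
begin

section \<open>Finite simple graphs\<close>

text \<open>A graph is given by a vertex set \<open>V\<close> and a set \<open>E\<close> of two-element subsets of \<open>V\<close>.\<close>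

definition simple_edges :: "'a set \<Rightarrow> 'a set set" where
  "simple_edges V = {{u, v} | u v. u \<in> V \<and> v \<in> V \<and> u \<noteq> v}"

definition finite_simple_graph :: "'a set \<Rightarrow> 'a set set \<Rightarrow> bool" where
  "finite_simple_graph V E \<longleftrightarrow> finite V \<and> E \<subseteq> simple_edges V"

definition compl_edges :: "'a set \<Rightarrow> 'a set set \<Rightarrow> 'a set set" where
  "compl_edges V E = simple_edges V - E"

definition induced_edges :: "'a set set \<Rightarrow> 'a set \<Rightarrow> 'a set set" where
  "induced_edges E A = {e \<in> E. e \<subseteq> A}"

definition cliques :: "'a set \<Rightarrow> 'a set set \<Rightarrow> 'a set set" where
  "cliques V E = {C. C \<subseteq> V \<and> (\<forall>u\<in>C. \<forall>v\<in>C. u \<noteq> v \<longrightarrow> {u, v} \<in> E)}"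


section \<open>The polynomial \<open>\<Delta>\<^sub>G\<close> and the set \<open>M\<^sub>G\<close>\<close>

text \<open>
  Points of \<open>\<real>\<^sup>V\<close> are functions \<open>'a \<Rightarrow> real\<close> of which only the values on \<open>V\<close> matter. In
  particular \<open>Delta A (induced_edges E A) x\<close> depends only on the restriction of \<open>x\<close> to \<open>A\<close>.
\<close>

definition Delta :: "'a set \<Rightarrow> 'a set set \<Rightarrow> ('a \<Rightarrow> real) \<Rightarrow> real" where
  "Delta V E x = (\<Sum>C\<in>cliques V (compl_edges V E). (-1) ^ card C * (\<Prod>i\<in>C. x i))"

definition M_set :: "'a set \<Rightarrow> 'a set set \<Rightarrow> ('a \<Rightarrow> real) set" where
  "M_set V E = {x. (\<forall>i\<in>V. 0 < x i) \<and> (\<forall>A. A \<subseteq> V \<longrightarrow> 0 < Delta A (induced_edges E A) x)}"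


section \<open>Formal power series in the variables indexed by \<open>V\<close>\<close>

text \<open>
  \<open>\<nat>\<^sup>V\<close> is represented by the functions vanishing outside \<open>V\<close>, and a formal power series in
  the variables \<open>X\<^sub>i\<close>, \<open>i \<in> V\<close>, by its coefficient function, which is zero outside \<open>\<nat>\<^sup>V\<close>.
\<close>

definition exponents :: "'a set \<Rightarrow> ('a \<Rightarrow> nat) set" where
  "exponents V = {n. \<forall>i. i \<notin> V \<longrightarrow> n i = 0}"

type_synonym 'a mfps = "('a \<Rightarrow> nat) \<Rightarrow> real"

definition mfps_monom :: "('a \<Rightarrow> nat) \<Rightarrow> 'a mfps" where
  "mfps_monom m = (\<lambda>n. if n = m then 1 else 0)"

definition mfps_one :: "'a mfps" where
  "mfps_one = mfps_monom (\<lambda>_. 0)"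

definition mfps_mult :: "'a mfps \<Rightarrow> 'a mfps \<Rightarrow> 'a mfps" where
  "mfps_mult f g = (\<lambda>n. \<Sum>k | k \<le> n. f k * g (\<lambda>i. n i - k i))"

definition mfps_inverse :: "'a set \<Rightarrow> 'a mfps \<Rightarrow> 'a mfps" where
  "mfps_inverse V f = (THE g. (\<forall>n. n \<notin> exponents V \<longrightarrow> g n = 0) \<and>
                              (\<forall>n\<in>exponents V. mfps_mult f g n = mfps_one n))"

text \<open>\<open>Delta_series V E\<close> is \<open>\<Delta>\<^sub>G\<close> read as a formal power series: the monomial of a clique
  \<open>C\<close> has exponent vector the indicator function of \<open>C\<close>.\<close>

definition Delta_series :: "'a set \<Rightarrow> 'a set set \<Rightarrow> 'a mfps" where
  "Delta_series V E =
     (\<lambda>n. \<Sum>C\<in>cliques V (compl_edges V E). (-1) ^ card C * mfps_monom (indicator C) n)"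

definition graph_multinomial :: "'a set \<Rightarrow> 'a set set \<Rightarrow> ('a \<Rightarrow> nat) \<Rightarrow> real" where
  "graph_multinomial V E = mfps_inverse V (Delta_series V E)"


section \<open>The free quotient monoid\<close>

definition word_adj :: "'a set \<Rightarrow> 'a set set \<Rightarrow> ('a list \<times> 'a list) set" where
  "word_adj V E =
     {(w1 @ [i1, i2] @ w2, w1 @ [i2, i1] @ w2) | w1 w2 i1 i2.
        w1 \<in> lists V \<and> w2 \<in> lists V \<and> {i1, i2} \<in> compl_edges V E}"

text \<open>\<open>word_adj V E\<close> is symmetric, so its reflexive transitive closure is an equivalence.\<close>

definition word_equiv :: "'a set \<Rightarrow> 'a set set \<Rightarrow> ('a list \<times> 'a list) set" where
  "word_equiv V E = (word_adj V E)\<^sup>* \<inter> (lists V \<times> lists V)"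

definition word_class :: "'a set \<Rightarrow> 'a set set \<Rightarrow> 'a list \<Rightarrow> 'a list set" where
  "word_class V E w = word_equiv V E `` {w}"

definition free_quotient_monoid :: "'a set \<Rightarrow> 'a set set \<Rightarrow> 'a list set monoid" where
  "free_quotient_monoid V E =
     \<lparr>carrier = lists V // word_equiv V E,
      mult = (\<lambda>a b. \<Union>u\<in>a. \<Union>v\<in>b. word_class V E (u @ v)),
      one = word_class V E []\<rparr>"

definition word_weight :: "('a \<Rightarrow> real) \<Rightarrow> 'a list \<Rightarrow> real" where
  "word_weight x w = (\<Prod>i\<leftarrow>w. x i)"

text \<open>The weight and the letter counts are constant on equivalence classes; \<open>the_elem\<close> extracts
  the common value (lemmas \<open>class_weight_word_class\<close> and \<open>class_count_word_class\<close> below).\<close>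

definition class_weight :: "('a \<Rightarrow> real) \<Rightarrow> 'a list set \<Rightarrow> real" where
  "class_weight x c = the_elem (word_weight x ` c)"

definition class_count :: "'a list set \<Rightarrow> 'a \<Rightarrow> nat" where
  "class_count c = the_elem (count_list ` c)"


section \<open>Well-definedness\<close>

lemma finite_le_exponents:
  assumes "finite V" "n \<in> exponents V"
  shows "finite {k. k \<le> n}"
proof -
  have "{k. k \<le> n} \<subseteq> {k. \<forall>i. (i \<in> V \<longrightarrow> k i \<in> {..Max (n ` V)}) \<and> (i \<notin> V \<longrightarrow> k i = 0)}"
  proof (rule subsetI)
    fix k assume "k \<in> {k. k \<le> n}"
    then have k: "k \<le> n" by simp
    have "k i \<le> Max (n ` V)" if "i \<in> V" for i
      using le_funD[OF k, of i] that assms(1) by (meson Max_ge finite_imageI imageI order_trans)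
    moreover have "k i = 0" if "i \<notin> V" for i
      using le_funD[OF k, of i] that assms(2) by (auto simp: exponents_def)
    ultimately show "k \<in> {k. \<forall>i. (i \<in> V \<longrightarrow> k i \<in> {..Max (n ` V)}) \<and> (i \<notin> V \<longrightarrow> k i = 0)}"
      by auto
  qed
  then show ?thesis
    by (rule finite_subset) (rule finite_set_of_finite_funs[OF assms(1)], simp)
qed

lemma mfps_mult_split:
  assumes "finite V" "n \<in> exponents V"
  shows "mfps_mult f g n =
    f (\<lambda>_. 0) * g n + (\<Sum>k | k \<le> n \<and> k \<noteq> (\<lambda>_. 0). f k * g (\<lambda>i. n i - k i))"
proof -
  have "{k. k \<le> n} = insert (\<lambda>_. 0) {k. k \<le> n \<and> k \<noteq> (\<lambda>_. 0)}"
    by (auto simp: le_fun_def)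
  moreover have "finite {k. k \<le> n \<and> k \<noteq> (\<lambda>_. 0)}"
    by (rule finite_subset[OF _ finite_le_exponents[OF assms]]) auto
  ultimately show ?thesis
    unfolding mfps_mult_def by simp
qed

lemma exponents_diff_less:
  assumes "finite V" "n \<in> exponents V" "k \<le> n" "k \<noteq> (\<lambda>_. 0)"
  shows "(\<lambda>i. n i - k i) \<in> exponents V" "(\<Sum>i\<in>V. n i - k i) < sum n V"
proof -
  show "(\<lambda>i. n i - k i) \<in> exponents V"
    using assms(2) by (auto simp: exponents_def)
  obtain j where j: "k j \<noteq> 0" using assms(4) by auto
  have "j \<in> V" using j le_funD[OF assms(3), of j] assms(2) by (auto simp: exponents_def)
  then show "(\<Sum>i\<in>V. n i - k i) < sum n V"
    using j le_funD[OF assms(3), of j] assms(1) by (intro sum_strict_mono_ex1) (auto intro!: bexI[of _ j])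
qed

lemma mfps_inverse_ex1:
  assumes "finite V" and f0: "f (\<lambda>_. 0) \<noteq> 0"
  shows "\<exists>!g. (\<forall>n. n \<notin> exponents V \<longrightarrow> g n = 0) \<and>
              (\<forall>n\<in>exponents V. mfps_mult f g n = mfps_one n)"
proof (rule ex_ex1I)
  define R where "R = Wellfounded.measure (\<lambda>n :: 'a \<Rightarrow> nat. sum n V)"
  define F where "F = (\<lambda>h n. if n \<in> exponents V
    then (mfps_one n - (\<Sum>k | k \<le> n \<and> k \<noteq> (\<lambda>_. 0). f k * h (\<lambda>i. n i - k i))) / f (\<lambda>_. 0)
    else (0::real))"
  define g where "g = wfrec R F"
  have wfR: "wf R" by (simp add: R_def)
  have g_rec: "g n = F g n" for n
  proof -
    have "g n = F (cut g R n) n"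
      unfolding g_def by (rule wfrec[OF wfR])
    also have "\<dots> = F g n"
    proof (cases "n \<in> exponents V")
      case True
      have "cut g R n (\<lambda>i. n i - k i) = g (\<lambda>i. n i - k i)" if "k \<le> n" "k \<noteq> (\<lambda>_. 0)" for k
        using exponents_diff_less(2)[OF assms(1) True that] by (simp add: cut_def R_def)
      then have "(\<Sum>k | k \<le> n \<and> k \<noteq> (\<lambda>_. 0). f k * cut g R n (\<lambda>i. n i - k i)) =
                 (\<Sum>k | k \<le> n \<and> k \<noteq> (\<lambda>_. 0). f k * g (\<lambda>i. n i - k i))"
        by (intro sum.cong) auto
      then show ?thesis by (simp add: F_def)
    qed (simp add: F_def)
    finally show ?thesis .
  qed
  have "g n = 0" if "n \<notin> exponents V" for n
    using g_rec[of n] that by (simp add: F_def)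
  moreover have "mfps_mult f g n = mfps_one n" if "n \<in> exponents V" for n
    using g_rec[of n] that f0 by (simp add: F_def mfps_mult_split[OF assms(1) that] field_simps)
  ultimately show "\<exists>g. (\<forall>n. n \<notin> exponents V \<longrightarrow> g n = 0) \<and>
              (\<forall>n\<in>exponents V. mfps_mult f g n = mfps_one n)"
    by (intro exI[of _ g]) simp
next
  fix g h
  assume g: "(\<forall>n. n \<notin> exponents V \<longrightarrow> g n = 0) \<and>
              (\<forall>n\<in>exponents V. mfps_mult f g n = mfps_one n)"
    and h: "(\<forall>n. n \<notin> exponents V \<longrightarrow> h n = 0) \<and>
              (\<forall>n\<in>exponents V. mfps_mult f h n = mfps_one n)"
  have "g n = h n" for n
  proof (induction "sum n V" arbitrary: n rule: less_induct)
    case less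
    show ?case
    proof (cases "n \<in> exponents V")
      case True
      have "(\<Sum>k | k \<le> n \<and> k \<noteq> (\<lambda>_. 0). f k * g (\<lambda>i. n i - k i)) =
            (\<Sum>k | k \<le> n \<and> k \<noteq> (\<lambda>_. 0). f k * h (\<lambda>i. n i - k i))"
        using exponents_diff_less(2)[OF assms(1) True] less by (intro sum.cong) auto
      moreover have "mfps_mult f g n = mfps_mult f h n" using g h True by simp
      ultimately show ?thesis
        using f0 by (simp add: mfps_mult_split[OF assms(1) True])
    qed (use g h in simp)
  qed
  then show "g = h" by (rule ext)
qed

lemma finite_cliques: "finite V \<Longrightarrow> finite (cliques V E)"
  by (rule finite_subset[of _ "Pow V"]) (auto simp: cliques_def)

lemma Delta_series_0:
  assumes "finite V"
  shows "Delta_series V E (\<lambda>_. 0) = 1"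
proof -
  have eq: "(\<lambda>_. 0) = (indicator C :: 'a \<Rightarrow> nat) \<longleftrightarrow> C = {}" for C
    by (auto simp: fun_eq_iff indicator_def)
  have "Delta_series V E (\<lambda>_. 0) =
      (\<Sum>C\<in>cliques V (compl_edges V E). if C = {} then 1 else 0)"
    unfolding Delta_series_def mfps_monom_def eq by (intro sum.cong) auto
  also have "\<dots> = 1"
    using finite_cliques[OF assms] by (subst sum.delta) (auto simp: cliques_def)
  finally show ?thesis .
qed

theorem graph_multinomial_inverse:
  assumes "finite V"
  shows "n \<notin> exponents V \<Longrightarrow> graph_multinomial V E n = 0"
    and "n \<in> exponents V \<Longrightarrow>
      mfps_mult (Delta_series V E) (graph_multinomial V E) n = mfps_one n"
  using theI'[OF mfps_inverse_ex1[OF assms, of "Delta_series V E"]]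
  by (simp_all add: Delta_series_0[OF assms] graph_multinomial_def mfps_inverse_def)

lemma word_adjI:
  assumes "a = w1 @ [i1, i2] @ w2" "b = w1 @ [i2, i1] @ w2"
    and "w1 \<in> lists V" "w2 \<in> lists V" "{i1, i2} \<in> compl_edges V E"
  shows "(a, b) \<in> word_adj V E"
  unfolding word_adj_def mem_Collect_eq
  by (rule exI[of _ w1], rule exI[of _ w2], rule exI[of _ i1], rule exI[of _ i2])
    (intro conjI assms(3-5), simp only: assms(1,2))

lemma word_adjE:
  assumes "(a, b) \<in> word_adj V E"
  obtains w1 w2 i1 i2 where "a = w1 @ [i1, i2] @ w2" "b = w1 @ [i2, i1] @ w2"
    "w1 \<in> lists V" "w2 \<in> lists V" "{i1, i2} \<in> compl_edges V E"
  using assms unfolding word_adj_def mem_Collect_eq prod.inject by (elim exE conjE)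

lemma sym_word_adj: "sym (word_adj V E)"
proof (rule symI)
  fix a b assume "(a, b) \<in> word_adj V E"
  then obtain w1 w2 i1 i2 where "a = w1 @ [i1, i2] @ w2" "b = w1 @ [i2, i1] @ w2"
    "w1 \<in> lists V" "w2 \<in> lists V" "{i2, i1} \<in> compl_edges V E"
    unfolding word_adj_def by (auto simp: insert_commute)
  from this(2,1,3-5) show "(b, a) \<in> word_adj V E" by (rule word_adjI)
qed

lemma equiv_word_equiv: "equiv (lists V) (word_equiv V E)"
proof (rule equivI)
  show "refl_on (lists V) (word_equiv V E)"
    by (auto simp: refl_on_def word_equiv_def)
  show "sym (word_equiv V E)"
    using sym_rtrancl[OF sym_word_adj[of V E]] by (auto simp: sym_def word_equiv_def)
  show "trans (word_equiv V E)"
    by (auto intro!: transI simp: word_equiv_def)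
qed (auto simp: word_equiv_def)

lemma word_equiv_weight:
  assumes "(u, v) \<in> word_equiv V E"
  shows "word_weight x u = word_weight x v"
proof -
  have "(u, v) \<in> (word_adj V E)\<^sup>*" using assms by (simp add: word_equiv_def)
  then show ?thesis
    by (induction rule: rtrancl_induct) (auto simp: word_adj_def word_weight_def)
qed

lemma word_equiv_count:
  assumes "(u, v) \<in> word_equiv V E"
  shows "count_list u = count_list v"
proof -
  have "(u, v) \<in> (word_adj V E)\<^sup>*" using assms by (simp add: word_equiv_def)
  then show ?thesis
    by (induction rule: rtrancl_induct) (auto simp: word_adj_def fun_eq_iff)
qed

lemma word_in_word_class: "w \<in> lists V \<Longrightarrow> w \<in> word_class V E w"
  by (auto simp: word_class_def word_equiv_def)

lemma class_weight_word_class: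
  assumes "w \<in> lists V"
  shows "class_weight x (word_class V E w) = word_weight x w"
proof -
  have "word_weight x ` word_class V E w = {word_weight x w}"
  proof (intro equalityI subsetI)
    fix y assume "y \<in> word_weight x ` word_class V E w"
    then obtain u where "(w, u) \<in> word_equiv V E" "y = word_weight x u"
      by (auto simp: word_class_def)
    then show "y \<in> {word_weight x w}" using word_equiv_weight[of w u V E] by simp
  qed (use word_in_word_class[OF assms] in auto)
  then show ?thesis by (simp add: class_weight_def)
qed

lemma class_count_word_class:
  assumes "w \<in> lists V"
  shows "class_count (word_class V E w) = count_list w"
proof -
  have "count_list ` word_class V E w = {count_list w}"
  proof (intro equalityI subsetI)
    fix y assume "y \<in> count_list ` word_class V E w"
    then obtain u where "(w, u) \<in> word_equiv V E" "y = count_list u"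
      by (auto simp: word_class_def)
    then show "y \<in> {count_list w}" using word_equiv_count[of w u V E] by simp
  qed (use word_in_word_class[OF assms] in auto)
  then show ?thesis by (simp add: class_count_def)
qed

lemma word_equiv_append:
  assumes "(u, u') \<in> word_equiv V E" "(v, v') \<in> word_equiv V E"
  shows "(u @ v, u' @ v') \<in> word_equiv V E"
proof -
  have right: "(a @ v, b @ v) \<in> word_adj V E"
    if ab: "(a, b) \<in> word_adj V E" and w0: "v \<in> lists V" for a b v
  proof -
    obtain w1 w2 i1 i2 where w: "a = w1 @ [i1, i2] @ w2" "b = w1 @ [i2, i1] @ w2"
      "w1 \<in> lists V" "w2 \<in> lists V" "{i1, i2} \<in> compl_edges V E"
      using ab by (rule word_adjE)
    show ?thesis
      by (rule word_adjI[of _ "w1" i1 i2 "w2 @ v"]) (use w w0 in simp_all)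
  qed
  have left: "(u @ a, u @ b) \<in> word_adj V E"
    if ab: "(a, b) \<in> word_adj V E" and w0: "u \<in> lists V" for a b u
  proof -
    obtain w1 w2 i1 i2 where w: "a = w1 @ [i1, i2] @ w2" "b = w1 @ [i2, i1] @ w2"
      "w1 \<in> lists V" "w2 \<in> lists V" "{i1, i2} \<in> compl_edges V E"
      using ab by (rule word_adjE)
    show ?thesis
      by (rule word_adjI[of _ "u @ w1" i1 i2 "w2"]) (use w w0 in simp_all)
  qed
  have "(u, u') \<in> (word_adj V E)\<^sup>*" "(v, v') \<in> (word_adj V E)\<^sup>*"
    and in_lists: "u \<in> lists V" "u' \<in> lists V" "v \<in> lists V" "v' \<in> lists V"
    using assms by (auto simp: word_equiv_def)
  have "(u @ v, u' @ v) \<in> (word_adj V E)\<^sup>*"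
    using \<open>(u, u') \<in> (word_adj V E)\<^sup>*\<close>
  proof (induction rule: rtrancl_induct)
    case (step y z)
    then show ?case
      using rtrancl_into_rtrancl[OF step.IH right[OF step.hyps(2)]] in_lists by simp
  qed simp
  also have "(u' @ v, u' @ v') \<in> (word_adj V E)\<^sup>*"
    using \<open>(v, v') \<in> (word_adj V E)\<^sup>*\<close>
  proof (induction rule: rtrancl_induct)
    case (step y z)
    then show ?case
      using rtrancl_into_rtrancl[OF step.IH left[OF step.hyps(2)]] in_lists by simp
  qed simp
  finally show ?thesis
    using in_lists by (simp add: word_equiv_def)
qed

lemma mult_word_class:
  assumes "u \<in> lists V" "v \<in> lists V"
  shows "word_class V E u \<otimes>\<^bsub>free_quotient_monoid V E\<^esub> word_class V E v = word_class V E (u @ v)"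
proof -
  have "word_class V E (u' @ v') = word_class V E (u @ v)"
    if "u' \<in> word_class V E u" "v' \<in> word_class V E v" for u' v'
  proof -
    have "(u @ v, u' @ v') \<in> word_equiv V E"
      using that by (intro word_equiv_append) (simp_all add: word_class_def)
    from equiv_class_eq[OF equiv_word_equiv this] show ?thesis
      by (simp add: word_class_def)
  qed
  then have "(\<Union>u'\<in>word_class V E u. \<Union>v'\<in>word_class V E v. word_class V E (u' @ v')) =
             (\<Union>u'\<in>word_class V E u. \<Union>v'\<in>word_class V E v. word_class V E (u @ v))"
    by (intro SUP_cong refl)
  also have "\<dots> = word_class V E (u @ v)"
    using word_in_word_class[OF assms(1)] word_in_word_class[OF assms(2)] by blast
  finally show ?thesis
    by (simp add: free_quotient_monoid_def)
qed

lemma carrier_free_quotient_monoid: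
  "carrier (free_quotient_monoid V E) = word_class V E ` lists V"
  by (auto simp: free_quotient_monoid_def quotient_def word_class_def)

theorem monoid_free_quotient_monoid: "monoid (free_quotient_monoid V E)"
proof (rule monoidI)
  have one: "\<one>\<^bsub>free_quotient_monoid V E\<^esub> = word_class V E []"
    by (simp add: free_quotient_monoid_def)
  have lists_append: "u @ v \<in> lists V" if "u \<in> lists V" "v \<in> lists V" for u v
    using that by simp
  show "\<one>\<^bsub>free_quotient_monoid V E\<^esub> \<in> carrier (free_quotient_monoid V E)"
    unfolding one carrier_free_quotient_monoid by (rule imageI) simp
  fix a b c
  assume "a \<in> carrier (free_quotient_monoid V E)"
  then obtain u where u: "u \<in> lists V" "a = word_class V E u"
    unfolding carrier_free_quotient_monoid by blast
  show "\<one>\<^bsub>free_quotient_monoid V E\<^esub> \<otimes>\<^bsub>free_quotient_monoid V E\<^esub> a = a"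
    and "a \<otimes>\<^bsub>free_quotient_monoid V E\<^esub> \<one>\<^bsub>free_quotient_monoid V E\<^esub> = a"
    using mult_word_class[of "[]" V u E] mult_word_class[of u V "[]" E] u by (simp_all add: one)
  assume "b \<in> carrier (free_quotient_monoid V E)"
  then obtain v where v: "v \<in> lists V" "b = word_class V E v"
    unfolding carrier_free_quotient_monoid by blast
  show "a \<otimes>\<^bsub>free_quotient_monoid V E\<^esub> b \<in> carrier (free_quotient_monoid V E)"
    unfolding u(2) v(2) mult_word_class[OF u(1) v(1)] carrier_free_quotient_monoid
    by (rule imageI) (rule lists_append[OF u(1) v(1)])
  assume "c \<in> carrier (free_quotient_monoid V E)"
  then obtain w where w: "w \<in> lists V" "c = word_class V E w"
    unfolding carrier_free_quotient_monoid by blast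
  show "a \<otimes>\<^bsub>free_quotient_monoid V E\<^esub> b \<otimes>\<^bsub>free_quotient_monoid V E\<^esub> c =
        a \<otimes>\<^bsub>free_quotient_monoid V E\<^esub> (b \<otimes>\<^bsub>free_quotient_monoid V E\<^esub> c)"
    unfolding u(2) v(2) w(2) mult_word_class[OF u(1) v(1)] mult_word_class[OF v(1) w(1)]
      mult_word_class[OF lists_append[OF u(1) v(1)] w(1)]
      mult_word_class[OF u(1) lists_append[OF v(1) w(1)]] by simp
qed

end

theory Submission
  imports Defs
begin

text \<open>Let \<open>F\<close> be the set of commuting pairs, that is, the edges of the complement graph. All traces (elements
of the quotient monoid) with letter count \<open>n\<close> have the same weight \<open>x\<^sup>n\<close>, so the probability that the
random trace has letter count \<open>n\<close> is the number of such traces times \<open>x\<^sup>n\<close>, divided by the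
total weight of all traces. Three things have to be shown: the number of traces with letter
count \<open>n\<close> is the coefficient of \<open>1 / \<Delta>\<^sub>G\<close> at \<open>n\<close>, the total weight is finite if \<open>x \<in> M\<^sub>G\<close>, and it then
equals \<open>1 / \<Delta>\<^sub>G(x)\<close>.

All three come from the inversion of Cartier and Foata, \<open>clique_inversion\<close>: in the sum of
\<open>(-1)\<^bsup>|C|\<^esup> f(C \<cdot> t)\<close> over the cliques \<open>C\<close> of \<open>F\<close> inside \<open>A\<close> and all traces \<open>t\<close>, everything cancels
except the values \<open>f(s)\<close> at the traces \<open>s\<close> that have no initial letter in \<open>A\<close>. It rests on two facts about
traces. Left multiplication is injective, and a clique divides a trace on the left iff each of its
letters does, while the letters that do so always form a clique. Both are proved by describing a trace through
its projections to the pairs of letters that do not commute: two words are equivalent iff all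
these projections agree.

With \<open>A = V\<close>, only the empty trace is left. Taking for \<open>f\<close> the indicator of a letter count gives
the coefficients (\<open>graph_multinomial_eq_trace_number\<close>), and taking the weight gives the
total (\<open>Delta_times_total_weight\<close>) once it is known to be finite.

Finiteness (\<open>class_weight_summable\<close>) is proved by adding one vertex \<open>v\<close> to a set \<open>W\<close>. With \<open>N\<close> the set of
vertices of \<open>W\<close> commuting with \<open>v\<close>, the weight series by length, \<open>z\<close>, satisfies a renewal
equation \<open>z\<^sub>V = z\<^sub>W + x\<^sub>v T p z\<^sub>V\<close>, where \<open>p\<close> is the weight series of the traces over \<open>W\<close> with no initial
letter in \<open>N\<close>. By the inversion with \<open>A = N\<close>, \<open>p\<close> sums to \<open>\<Delta>\<^sub>N / \<Delta>\<^sub>W\<close>, and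
\<open>\<Delta>\<^sub>V = \<Delta>\<^sub>W - x\<^sub>v \<Delta>\<^sub>N > 0\<close> says exactly that the mass \<open>x\<^sub>v \<Delta>\<^sub>N / \<Delta>\<^sub>W\<close> of the renewal kernel is less than 1.\<close>

section \<open>Words and their projections to pairs of letters\<close>

text \<open>In the following, \<open>F\<close> is the set of pairs of letters that commute, which will be
\<open>compl_edges V E\<close>. The case \<open>a = b\<close> always counts as noncommuting there,
so that equal projections include equal letter counts.\<close>

definition same_projections :: "'a set set \<Rightarrow> 'a list \<Rightarrow> 'a list \<Rightarrow> bool" where
  "same_projections F u v \<longleftrightarrow>
     (\<forall>a b. {a, b} \<notin> F \<longrightarrow> filter (\<lambda>c. c \<in> {a, b}) u = filter (\<lambda>c. c \<in> {a, b}) v)"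

text \<open>Seen through the projections, \<open>a\<close> can be brought to the front of \<open>w\<close> iff it occurs in \<open>w\<close> and
precedes every letter with which it does not commute; the case \<open>b = a\<close> gives the occurrence.\<close>

definition can_start :: "'a set set \<Rightarrow> 'a \<Rightarrow> 'a list \<Rightarrow> bool" where
  "can_start F a w \<longleftrightarrow> (\<forall>b. {a, b} \<notin> F \<longrightarrow> (\<exists>r. filter (\<lambda>c. c \<in> {a, b}) w = a # r))"

lemma same_projections_trans:
  "same_projections F u v \<Longrightarrow> same_projections F v w \<Longrightarrow> same_projections F u w"
  unfolding same_projections_def by metis

lemma same_projections_cancel:
  assumes "same_projections F (w @ u) (w @ v)"
  shows "same_projections F u v"
  unfolding same_projections_def
proof (intro allI impI)
  fix a b assume "{a, b} \<notin> F"
  then have "filter (\<lambda>c. c \<in> {a, b}) (w @ u) = filter (\<lambda>c. c \<in> {a, b}) (w @ v)"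
    using assms unfolding same_projections_def by blast
  then show "filter (\<lambda>c. c \<in> {a, b}) u = filter (\<lambda>c. c \<in> {a, b}) v"
    unfolding filter_append by (rule same_append_eq[THEN iffD1])
qed

lemma compl_edges_irrefl: "{a, a} \<notin> compl_edges V E"
  by (auto simp: compl_edges_def simple_edges_def doubleton_eq_iff)

text \<open>A single swap exchanges two distinct commuting letters, and a projection to a noncommuting pair
keeps at most one of them.\<close>

lemma word_equiv_imp_same_projections:
  assumes "(u, v) \<in> word_equiv V E"
  shows "same_projections (compl_edges V E) u v"
proof -
  have "(u, v) \<in> (word_adj V E)\<^sup>*" using assms by (simp add: word_equiv_def)
  then show ?thesis
  proof (induction rule: rtrancl_induct)
    case (step v w)
    have "same_projections (compl_edges V E) v w"
      using step.hyps(2)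
    proof (rule word_adjE)
      fix p q i j
      assume vw: "v = p @ [i, j] @ q" "w = p @ [j, i] @ q" and ij: "{i, j} \<in> compl_edges V E"
      have "i \<noteq> j" using ij compl_edges_irrefl by metis
      then have "\<not> (i \<in> {a, b} \<and> j \<in> {a, b})" if "{a, b} \<notin> compl_edges V E" for a b
        using ij that by (auto simp: insert_commute)
      then show ?thesis
        unfolding same_projections_def vw by auto
    qed
    with step.IH show ?case by (rule same_projections_trans)
  qed (simp add: same_projections_def)
qed

lemma word_equiv_refl: "u \<in> lists V \<Longrightarrow> (u, u) \<in> word_equiv V E"
  by (simp add: word_equiv_def)

lemma word_equiv_sym: "(u, v) \<in> word_equiv V E \<Longrightarrow> (v, u) \<in> word_equiv V E"
  using equiv_word_equiv[of V E] by (meson equivE symD)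

lemma word_equiv_trans:
  "(u, v) \<in> word_equiv V E \<Longrightarrow> (v, w) \<in> word_equiv V E \<Longrightarrow> (u, w) \<in> word_equiv V E"
  using equiv_word_equiv[of V E] by (meson equivE transD)

lemma word_equiv_lists:
  "(u, v) \<in> word_equiv V E \<Longrightarrow> u \<in> lists V" "(u, v) \<in> word_equiv V E \<Longrightarrow> v \<in> lists V"
  by (simp_all add: word_equiv_def)

lemma word_equiv_Cons:
  assumes "a \<in> V" "(u, v) \<in> word_equiv V E"
  shows "(a # u, a # v) \<in> word_equiv V E"
  using word_equiv_append[OF word_equiv_refl[of "[a]" V E] assms(2)] assms(1) by simp

lemma word_equiv_move_to_front:
  assumes "\<forall>b\<in>set p. {a, b} \<in> compl_edges V E" "p @ a # q \<in> lists V"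
  shows "(p @ a # q, a # p @ q) \<in> word_equiv V E"
  using assms
proof (induction p)
  case (Cons c p)
  have "(c # p @ a # q, c # a # p @ q) \<in> word_equiv V E"
    using Cons by (intro word_equiv_Cons) auto
  moreover have "(c # a # p @ q, a # c # p @ q) \<in> word_adj V E"
    using Cons.prems by (intro word_adjI[of _ "[]" c a "p @ q"]) (auto simp: insert_commute)
  then have "(c # a # p @ q, a # c # p @ q) \<in> word_equiv V E"
    using Cons.prems by (auto simp: word_equiv_def)
  ultimately show ?case using word_equiv_trans by fastforce
qed (simp add: word_equiv_refl)

text \<open>Split \<open>w\<close> at the first \<open>a\<close>. A letter \<open>b\<close> before it that does not commute with \<open>a\<close> would make
the projection to \<open>{a, b}\<close> start with \<open>b\<close>.\<close>

lemma can_start_split: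
  assumes "can_start F a w" "{a, a} \<notin> F"
  obtains p q where "w = p @ a # q" "\<forall>b\<in>set p. {a, b} \<in> F"
proof -
  obtain r where "filter (\<lambda>c. c \<in> {a, a}) w = a # r"
    using assms unfolding can_start_def by blast
  then have "a \<in> set (filter (\<lambda>c. c \<in> {a, a}) w)" by simp
  then have "a \<in> set w" by simp
  then obtain p q where w: "w = p @ a # q" "a \<notin> set p"
    by (meson split_list_first)
  have "{a, b} \<in> F" if b: "b \<in> set p" for b
  proof (rule ccontr)
    assume "{a, b} \<notin> F"
    then obtain r where r: "filter (\<lambda>c. c \<in> {a, b}) w = a # r"
      using assms unfolding can_start_def by blast
    have "filter (\<lambda>c. c \<in> {a, b}) p \<noteq> []" using b by (auto simp: filter_empty_conv)
    then obtain d ds where d: "filter (\<lambda>c. c \<in> {a, b}) p = d # ds"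
      by (meson neq_Nil_conv)
    then have "d \<in> set (filter (\<lambda>c. c \<in> {a, b}) p)" by simp
    then have "d \<in> set p" by simp
    moreover have "d = a" using r d w by simp
    ultimately show False using w by simp
  qed
  then show ?thesis using that w by blast
qed

lemma can_start_Cons: "can_start F a (a # u)"
  by (auto simp: can_start_def)

lemma can_start_cong:
  assumes "same_projections F u v"
  shows "can_start F a u \<longleftrightarrow> can_start F a v"
proof -
  have "(\<exists>r. filter (\<lambda>c. c \<in> {a, b}) u = a # r) \<longleftrightarrow> (\<exists>r. filter (\<lambda>c. c \<in> {a, b}) v = a # r)"
    if "{a, b} \<notin> F" for b
  proof -
    have "filter (\<lambda>c. c \<in> {a, b}) u = filter (\<lambda>c. c \<in> {a, b}) v"
      using assms that unfolding same_projections_def by blast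
    then show ?thesis by (rule arg_cong)
  qed
  then show ?thesis unfolding can_start_def by blast
qed

text \<open>Words with equal projections are equivalent: the first letter of \<open>u\<close> can be moved to the front
of \<open>v\<close>, and removing it from both words leaves words that again have equal projections.\<close>

lemma same_projections_imp_word_equiv:
  assumes "same_projections (compl_edges V E) u v" "u \<in> lists V" "v \<in> lists V"
  shows "(u, v) \<in> word_equiv V E"
  using assms
proof (induction u arbitrary: v)
  case Nil
  have "v = []"
  proof (rule ccontr)
    assume "v \<noteq> []"
    then obtain c v' where "v = c # v'" by (meson neq_Nil_conv)
    then have "filter (\<lambda>d. d \<in> {c, c}) v \<noteq> filter (\<lambda>d. d \<in> {c, c}) []" by simp
    then show False
      using Nil.prems(1) compl_edges_irrefl unfolding same_projections_def by metis
  qed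
  then show ?case by (simp add: word_equiv_refl)
next
  case (Cons a u)
  have "can_start (compl_edges V E) a v"
    using can_start_cong[OF Cons.prems(1)] can_start_Cons by fast
  then obtain p q where v: "v = p @ a # q" and p: "\<forall>b\<in>set p. {a, b} \<in> compl_edges V E"
    by (rule can_start_split[OF _ compl_edges_irrefl])
  have front: "(v, a # p @ q) \<in> word_equiv V E"
    unfolding v using p Cons.prems(3) v by (intro word_equiv_move_to_front) auto
  from word_equiv_imp_same_projections[OF this]
  have "same_projections (compl_edges V E) (a # u) (a # p @ q)"
    using Cons.prems(1) by (rule same_projections_trans[rotated])
  then have "same_projections (compl_edges V E) ([a] @ u) ([a] @ p @ q)" by simp
  then have "same_projections (compl_edges V E) u (p @ q)"
    by (rule same_projections_cancel)
  then have "(u, p @ q) \<in> word_equiv V E"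
    using Cons v by simp
  then have "(a # u, a # p @ q) \<in> word_equiv V E"
    using Cons.prems by (intro word_equiv_Cons) auto
  then show ?case using front word_equiv_sym word_equiv_trans by metis
qed

text \<open>Left cancellation is hard to see from sequences of swaps, since these may mix \<open>w\<close> with the rest,
but it is immediate for lists of projections.\<close>

lemma word_equiv_cancel_left:
  assumes "(w @ u, w @ v) \<in> word_equiv V E"
  shows "(u, v) \<in> word_equiv V E"
  using same_projections_cancel[OF word_equiv_imp_same_projections[OF assms]] word_equiv_lists[OF assms]
  by (intro same_projections_imp_word_equiv) auto

section \<open>Initial letters and division by cliques\<close>

text \<open>A class \<open>s\<close> of words is called a trace. Its initial letters are those by which it is
divisible on the left.\<close>

definition initials :: "'a list set \<Rightarrow> 'a set" where
  "initials s = {a. \<exists>u. a # u \<in> s}"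

lemma mem_initials_word_class:
  assumes "w \<in> lists V"
  shows "a \<in> initials (word_class V E w) \<longleftrightarrow> can_start (compl_edges V E) a w"
proof
  assume "a \<in> initials (word_class V E w)"
  then obtain u where "(w, a # u) \<in> word_equiv V E"
    by (auto simp: initials_def word_class_def)
  from can_start_cong[OF word_equiv_imp_same_projections[OF this]]
  show "can_start (compl_edges V E) a w" using can_start_Cons by fast
next
  assume "can_start (compl_edges V E) a w"
  then obtain p q where w: "w = p @ a # q" and p: "\<forall>b\<in>set p. {a, b} \<in> compl_edges V E"
    by (rule can_start_split[OF _ compl_edges_irrefl])
  have "(w, a # p @ q) \<in> word_equiv V E"
    unfolding w using p assms w by (intro word_equiv_move_to_front) auto
  then show "a \<in> initials (word_class V E w)"
    by (auto simp: initials_def word_class_def)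
qed

text \<open>If \<open>a\<close> and \<open>b\<close> did not commute, then the projection to \<open>{a, b}\<close> would have to start with both.\<close>

lemma initials_clique:
  assumes "s \<in> carrier (free_quotient_monoid V E)"
  shows "initials s \<in> cliques V (compl_edges V E)"
proof -
  obtain w where w: "w \<in> lists V" "s = word_class V E w"
    using assms unfolding carrier_free_quotient_monoid by blast
  have "a \<in> V" if "a \<in> initials s" for a
    using that w word_equiv_lists(2) by (fastforce simp: initials_def word_class_def)
  moreover have "{a, b} \<in> compl_edges V E" if ab: "a \<in> initials s" "b \<in> initials s" "a \<noteq> b" for a b
  proof (rule ccontr)
    assume n: "{a, b} \<notin> compl_edges V E"
    have "can_start (compl_edges V E) a w" "can_start (compl_edges V E) b w"
      using ab(1,2) w(2) mem_initials_word_class[OF w(1)] by auto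
    moreover have "{b, a} \<notin> compl_edges V E" using n by (simp only: insert_commute not_False_eq_True)
    ultimately obtain r r' where "filter (\<lambda>c. c \<in> {a, b}) w = a # r" "filter (\<lambda>c. c \<in> {b, a}) w = b # r'"
      using n unfolding can_start_def by blast
    then show False using ab(3) by (simp add: disj_commute)
  qed
  ultimately show ?thesis by (auto simp: cliques_def)
qed

lemma initials_empty_iff:
  assumes "s \<in> carrier (free_quotient_monoid V E)"
  shows "initials s = {} \<longleftrightarrow> s = word_class V E []"
proof -
  obtain w where w: "w \<in> lists V" "s = word_class V E w"
    using assms unfolding carrier_free_quotient_monoid by blast
  show ?thesis
  proof
    assume e: "initials s = {}"
    have "w = []"
    proof (rule ccontr)
      assume "w \<noteq> []"
      then obtain a u where "w = a # u" by (meson neq_Nil_conv)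
      then have "a \<in> initials s" using w word_in_word_class[of w V E] by (auto simp: initials_def)
      then show False using e by simp
    qed
    then show "s = word_class V E []" using w by simp
  next
    assume s: "s = word_class V E []"
    have "\<not> can_start (compl_edges V E) a []" for a
      using compl_edges_irrefl unfolding can_start_def by fastforce
    then show "initials s = {}"
      unfolding s using mem_initials_word_class[of "[]" V _ E] by auto
  qed
qed

text \<open>The order in which a clique is listed does not matter, because its letters commute.\<close>

definition clique_word :: "'a set \<Rightarrow> 'a list" where
  "clique_word C = (SOME cs. set cs = C \<and> distinct cs)"

lemma clique_word:
  assumes "finite C"
  shows "set (clique_word C) = C" "distinct (clique_word C)"
  using someI_ex[OF finite_distinct_list[OF assms]] by (simp_all add: clique_word_def)

lemma clique_subset: "C \<in> cliques V F \<Longrightarrow> C \<subseteq> V"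
  by (simp add: cliques_def)

lemma finite_clique: "finite V \<Longrightarrow> C \<in> cliques V F \<Longrightarrow> finite C"
  using finite_subset[OF clique_subset] by blast

lemma clique_word_in_lists:
  assumes "finite V" "C \<in> cliques V F"
  shows "clique_word C \<in> lists V"
  using clique_word(1)[OF finite_clique[OF assms]] clique_subset[OF assms(2)] by auto

text \<open>Split off the letters of the clique one by one. A letter \<open>b\<close> that could start the word still can
after a different letter \<open>a\<close> has been split off: \<open>a\<close> commutes with \<open>b\<close>, so it is not seen by the
projections that decide whether \<open>b\<close> can start.\<close>

lemma ex_factor_clique:
  assumes "w \<in> lists V" "distinct cs" "\<forall>a\<in>set cs. can_start (compl_edges V E) a w"
    and "\<And>a b. a \<in> set cs \<Longrightarrow> b \<in> set cs \<Longrightarrow> a \<noteq> b \<Longrightarrow> {a, b} \<in> compl_edges V E"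
  shows "\<exists>u\<in>lists V. (w, cs @ u) \<in> word_equiv V E"
  using assms
proof (induction cs arbitrary: w)
  case Nil
  then show ?case using word_equiv_refl[of w V E] by auto
next
  case (Cons a cs)
  have "a \<in> initials (word_class V E w)"
    using mem_initials_word_class[OF Cons.prems(1)] Cons.prems(3) by simp
  then obtain u where u: "(w, a # u) \<in> word_equiv V E"
    by (auto simp: initials_def word_class_def)
  have uV: "a \<in> V" "u \<in> lists V" using word_equiv_lists(2)[OF u] by auto
  have "can_start (compl_edges V E) b u" if b: "b \<in> set cs" for b
  proof -
    have ba: "b \<noteq> a" "{b, a} \<in> compl_edges V E" using Cons.prems b by auto
    have "can_start (compl_edges V E) b (a # u)"
      using can_start_cong[OF word_equiv_imp_same_projections[OF u]] Cons.prems(3) b by simp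
    moreover have "a \<noteq> c" if "{b, c} \<notin> compl_edges V E" for c
      using that ba by auto
    ultimately show ?thesis using ba(1) unfolding can_start_def by auto
  qed
  then have "\<exists>u'\<in>lists V. (u, cs @ u') \<in> word_equiv V E"
    using Cons.prems uV by (intro Cons.IH) auto
  then obtain u' where u': "u' \<in> lists V" "(u, cs @ u') \<in> word_equiv V E" by blast
  have "(w, a # cs @ u') \<in> word_equiv V E"
    using word_equiv_trans[OF u word_equiv_Cons[OF uV(1) u'(2)]] .
  then show ?case using u'(1) by auto
qed

lemma can_start_clique_append:
  assumes "a \<in> set cs"
    and "\<And>a b. a \<in> set cs \<Longrightarrow> b \<in> set cs \<Longrightarrow> a \<noteq> b \<Longrightarrow> {a, b} \<in> F"
  shows "can_start F a (cs @ u)"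
proof -
  obtain p q where cs: "cs = p @ a # q" "a \<notin> set p"
    using assms(1) by (meson split_list_first)
  have "filter (\<lambda>c. c \<in> {a, b}) p = []" if "{a, b} \<notin> F" for b
    unfolding filter_empty_conv
  proof
    fix c assume c: "c \<in> set p"
    then have "c \<noteq> a" "{a, c} \<in> F" using cs assms(2)[of a c] by auto
    then show "c \<notin> {a, b}" using that by auto
  qed
  then show ?thesis
    unfolding can_start_def cs by simp
qed

definition clique_mult :: "'a set \<Rightarrow> 'a set set \<Rightarrow> 'a set \<Rightarrow> 'a list set \<Rightarrow> 'a list set" where
  "clique_mult V E C t = word_class V E (clique_word C) \<otimes>\<^bsub>free_quotient_monoid V E\<^esub> t"

lemma clique_mult_word_class:
  assumes "finite V" "C \<in> cliques V F" "w \<in> lists V"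
  shows "clique_mult V E C (word_class V E w) = word_class V E (clique_word C @ w)"
  unfolding clique_mult_def using mult_word_class[OF clique_word_in_lists[OF assms(1,2)] assms(3)] .

lemma word_class_eq_iff:
  assumes "u \<in> lists V" "v \<in> lists V"
  shows "word_class V E u = word_class V E v \<longleftrightarrow> (u, v) \<in> word_equiv V E"
  unfolding word_class_def using eq_equiv_class_iff[OF equiv_word_equiv assms] .

lemma inj_on_clique_mult:
  assumes "finite V" "C \<in> cliques V F"
  shows "inj_on (clique_mult V E C) (carrier (free_quotient_monoid V E))"
proof (rule inj_onI)
  fix s t assume "s \<in> carrier (free_quotient_monoid V E)" "t \<in> carrier (free_quotient_monoid V E)"
  then obtain u v where uv: "u \<in> lists V" "s = word_class V E u" "v \<in> lists V" "t = word_class V E v"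
    unfolding carrier_free_quotient_monoid by blast
  have cw: "clique_word C \<in> lists V" by (rule clique_word_in_lists[OF assms])
  assume "clique_mult V E C s = clique_mult V E C t"
  then have "word_class V E (clique_word C @ u) = word_class V E (clique_word C @ v)"
    using uv clique_mult_word_class[OF assms] by metis
  then have "(clique_word C @ u, clique_word C @ v) \<in> word_equiv V E"
    using uv cw by (subst (asm) word_class_eq_iff) auto
  then show "s = t"
    using word_equiv_cancel_left uv word_class_eq_iff by metis
qed

text \<open>Together with injectivity, this says that left multiplication by a clique \<open>C\<close> is a bijection from
all traces onto those that admit every letter of \<open>C\<close> as an initial letter.\<close>

lemma image_clique_mult:
  assumes "finite V" and C: "C \<in> cliques V (compl_edges V E)"
  shows "clique_mult V E C ` carrier (free_quotient_monoid V E) =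
         {s \<in> carrier (free_quotient_monoid V E). C \<subseteq> initials s}" (is "?L = ?R")
proof (intro equalityI subsetI)
  have finC: "finite C" by (rule finite_clique[OF assms])
  have cl: "{a, b} \<in> compl_edges V E"
    if "a \<in> set (clique_word C)" "b \<in> set (clique_word C)" "a \<noteq> b" for a b
    using that C clique_word[OF finC] by (auto simp: cliques_def)
  have cw: "clique_word C \<in> lists V" by (rule clique_word_in_lists[OF assms])
  fix s
  {
    assume "s \<in> ?L"
    then obtain w where w: "w \<in> lists V" "s = clique_mult V E C (word_class V E w)"
      unfolding carrier_free_quotient_monoid by blast
    have s: "s = word_class V E (clique_word C @ w)"
      unfolding w(2) by (rule clique_mult_word_class[OF assms w(1)])
    have W: "clique_word C @ w \<in> lists V" using cw w by simp
    have "a \<in> initials s" if "a \<in> C" for a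
      unfolding s mem_initials_word_class[OF W]
      using that clique_word[OF finC] cl by (intro can_start_clique_append) auto
    then show "s \<in> ?R"
      using s W unfolding carrier_free_quotient_monoid by blast
  }
  {
    assume "s \<in> ?R"
    then obtain w where w: "w \<in> lists V" "s = word_class V E w" "C \<subseteq> initials s"
      unfolding carrier_free_quotient_monoid by blast
    have "\<exists>u\<in>lists V. (w, clique_word C @ u) \<in> word_equiv V E"
      using w cl clique_word[OF finC] mem_initials_word_class[OF w(1)]
      by (intro ex_factor_clique) auto
    then obtain u where u: "u \<in> lists V" "(w, clique_word C @ u) \<in> word_equiv V E" by blast
    then have "s = clique_mult V E C (word_class V E u)"
      using w cw clique_mult_word_class[OF assms] word_class_eq_iff[of w V "clique_word C @ u" E] by simp
    then show "s \<in> ?L"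
      using u unfolding carrier_free_quotient_monoid by blast
  }
qed

section \<open>Inversion over cliques\<close>

abbreviation traces :: "'a set \<Rightarrow> 'a set set \<Rightarrow> 'a list set set" where
  "traces V E \<equiv> carrier (free_quotient_monoid V E)"

lemma traces_cases:
  assumes "s \<in> traces V E"
  obtains w where "w \<in> lists V" "s = word_class V E w"
  using assms unfolding carrier_free_quotient_monoid by blast

lemma sum_alternating_Pow:
  assumes "finite A"
  shows "(\<Sum>C\<in>Pow A. (-1) ^ card C) = (of_bool (A = {}) :: real)"
  using prod_diff_conv_sum[OF assms, where ?f1.0 = "\<lambda>_. 1::real" and ?f2.0 = "\<lambda>_. 1"] assms
  by (cases "A = {}") (auto simp: power_0_left)

lemma infsum_sum_finite:
  fixes f :: "'i \<Rightarrow> 'b \<Rightarrow> real"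
  assumes "finite I" "\<And>i. i \<in> I \<Longrightarrow> f i summable_on T"
  shows "(\<Sum>\<^sub>\<infinity>t\<in>T. \<Sum>i\<in>I. f i t) = (\<Sum>i\<in>I. \<Sum>\<^sub>\<infinity>t\<in>T. f i t)"
proof (rule infsumI)
  show "((\<lambda>t. \<Sum>i\<in>I. f i t) has_sum (\<Sum>i\<in>I. \<Sum>\<^sub>\<infinity>t\<in>T. f i t)) T"
    using assms by (induction I rule: finite_induct) (auto intro!: has_sum_add)
qed

text \<open>Substituting \<open>s = C \<cdot> t\<close> turns the left-hand side into the sum over all traces \<open>s\<close> of
\<open>f s\<close> times the alternating sum over the cliques \<open>C\<close> of \<open>A\<close> that divide \<open>s\<close>. As the initial letters
of \<open>s\<close> form a clique, these are precisely the subsets of \<open>initials s \<inter> A\<close>, and the alternating sum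
vanishes unless this set is empty. Keeping \<open>f\<close> general allows the same inversion to be read
off coefficient by coefficient or on total weights, and allowing \<open>A\<close> to be smaller than \<open>V\<close>
yields the nonnegativity that drives the convergence proof.\<close>

theorem clique_inversion:
  fixes f :: "'a list set \<Rightarrow> real"
  assumes V: "finite V" "A \<subseteq> V" and f: "f summable_on traces V E"
  shows "(\<Sum>C\<in>cliques A (compl_edges V E).
            (-1) ^ card C * (\<Sum>\<^sub>\<infinity>t\<in>traces V E. f (clique_mult V E C t))) =
         (\<Sum>\<^sub>\<infinity>s\<in>traces V E. of_bool (initials s \<inter> A = {}) * f s)"
proof -
  let ?F = "compl_edges V E" and ?T = "traces V E"
  \<comment> \<open>Bounded multiples of \<open>f\<close> are summable, so the finite sum over cliques can be moved inside.\<close>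
  have sm: "(\<lambda>s. c s * f s) summable_on ?T" if c: "\<And>s. \<bar>c s\<bar> \<le> 1" for c :: "'a list set \<Rightarrow> real"
  proof (rule abs_summable_summable, rule summable_on_comparison_test)
    show "(\<lambda>s. norm (f s)) summable_on ?T"
      by (rule summable_on_iff_abs_summable_on_real[THEN iffD1, OF f])
    show "norm (c s * f s) \<le> norm (f s)" for s
      using mult_right_mono[OF c[of s], of "\<bar>f s\<bar>"] by (simp add: abs_mult)
  qed simp
  have "(\<Sum>\<^sub>\<infinity>t\<in>?T. f (clique_mult V E C t)) = (\<Sum>\<^sub>\<infinity>s\<in>?T. of_bool (C \<subseteq> initials s) * f s)"
    if C: "C \<in> cliques A ?F" for C
  proof -
    have C': "C \<in> cliques V ?F" using C V by (auto simp: cliques_def)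
    have "(\<Sum>\<^sub>\<infinity>t\<in>?T. f (clique_mult V E C t)) = (\<Sum>\<^sub>\<infinity>s\<in>clique_mult V E C ` ?T. f s)"
      using infsum_reindex[OF inj_on_clique_mult[OF V(1) C'], of f] by (simp add: o_def)
    also have "\<dots> = (\<Sum>\<^sub>\<infinity>s\<in>?T. of_bool (C \<subseteq> initials s) * f s)"
      unfolding image_clique_mult[OF V(1) C'] by (rule infsum_cong_neutral) auto
    finally show ?thesis .
  qed
  then have "(\<Sum>C\<in>cliques A ?F. (-1) ^ card C * (\<Sum>\<^sub>\<infinity>t\<in>?T. f (clique_mult V E C t))) =
      (\<Sum>C\<in>cliques A ?F. \<Sum>\<^sub>\<infinity>s\<in>?T. (-1) ^ card C * of_bool (C \<subseteq> initials s) * f s)"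
    by (simp add: infsum_cmult_right' mult.assoc)
  also have "\<dots> = (\<Sum>\<^sub>\<infinity>s\<in>?T. \<Sum>C\<in>cliques A ?F. (-1) ^ card C * of_bool (C \<subseteq> initials s) * f s)"
    using V by (intro infsum_sum_finite[symmetric] finite_cliques sm)
      (auto intro: finite_subset simp: abs_mult power_abs)
  also have "\<dots> = (\<Sum>\<^sub>\<infinity>s\<in>?T. of_bool (initials s \<inter> A = {}) * f s)"
  proof (rule infsum_cong)
    fix s assume s: "s \<in> ?T"
    have cl: "initials s \<in> cliques V ?F" by (rule initials_clique[OF s])
    have fin: "finite (initials s \<inter> A)" using finite_clique[OF V(1) cl] by simp
    have eq: "{C \<in> cliques A ?F. C \<subseteq> initials s} = Pow (initials s \<inter> A)"
      using cl by (auto simp: cliques_def)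
    have "(\<Sum>C\<in>cliques A ?F. (-1) ^ card C * of_bool (C \<subseteq> initials s) * f s) =
          (\<Sum>C\<in>cliques A ?F. if C \<subseteq> initials s then (-1) ^ card C else 0) * f s"
      unfolding sum_distrib_right by (intro sum.cong) auto
    also have "(\<Sum>C\<in>cliques A ?F. if C \<subseteq> initials s then (-1) ^ card C else (0::real)) =
        (\<Sum>C\<in>Pow (initials s \<inter> A). (-1) ^ card C)"
      using finite_cliques[OF finite_subset[OF V(2,1)], of ?F] unfolding eq[symmetric]
      by (intro sum.inter_filter[symmetric])
    finally show "(\<Sum>C\<in>cliques A ?F. (-1) ^ card C * of_bool (C \<subseteq> initials s) * f s) =
        of_bool (initials s \<inter> A = {}) * f s"
      unfolding sum_alternating_Pow[OF fin] .
  qed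
  finally show ?thesis .
qed

lemma trace_one: "word_class V E [] \<in> traces V E"
  unfolding carrier_free_quotient_monoid by (rule imageI) simp

text \<open>For \<open>A = V\<close> only the empty trace, which has no initial letter, survives.\<close>

corollary clique_inversion_full:
  fixes f :: "'a list set \<Rightarrow> real"
  assumes V: "finite V" and f: "f summable_on traces V E"
  shows "(\<Sum>C\<in>cliques V (compl_edges V E).
            (-1) ^ card C * (\<Sum>\<^sub>\<infinity>t\<in>traces V E. f (clique_mult V E C t))) = f (word_class V E [])"
proof -
  have "initials s \<inter> V = {} \<longleftrightarrow> s = word_class V E []" if "s \<in> traces V E" for s
    using initials_empty_iff[OF that] clique_subset[OF initials_clique[OF that]] by blast
  then have "(\<Sum>\<^sub>\<infinity>s\<in>traces V E. of_bool (initials s \<inter> V = {}) * f s) =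
      (\<Sum>\<^sub>\<infinity>s\<in>{word_class V E []}. f s)"
    using trace_one[of V E] by (intro infsum_cong_neutral) auto
  then show ?thesis using clique_inversion[OF V order_refl f] by simp
qed

section \<open>Letter counts, weights and the coefficients of the inverse series\<close>

lemma count_list_distinct: "distinct ws \<Longrightarrow> count_list ws i = indicator (set ws) i"
  by (induction ws) (auto simp: indicator_def)

lemma count_list_clique_word:
  assumes "finite C"
  shows "count_list (clique_word C) = indicator C"
  using clique_word[OF assms] count_list_distinct[of "clique_word C"] by (simp add: fun_eq_iff)

lemma class_count_clique_mult:
  assumes "finite V" "C \<in> cliques V F" "t \<in> traces V E"
  shows "class_count (clique_mult V E C t) = (\<lambda>i. indicator C i + class_count t i)"
proof -
  obtain w where w: "w \<in> lists V" "t = word_class V E w" using assms(3) by (rule traces_cases)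
  have "clique_word C @ w \<in> lists V" using clique_word_in_lists[OF assms(1,2)] w by simp
  then show ?thesis
    using w class_count_word_class[of w V E] class_count_word_class[of "clique_word C @ w" V E]
    by (simp add: clique_mult_word_class[OF assms(1,2)] fun_eq_iff
        count_list_clique_word[OF finite_clique[OF assms(1,2)]])
qed

lemma word_weight_count:
  assumes "finite V" "w \<in> lists V"
  shows "word_weight x w = (\<Prod>i\<in>V. x i ^ count_list w i)"
  using assms(2)
proof (induction w)
  case (Cons a w)
  have "(\<Prod>i\<in>V. x i ^ count_list (a # w) i) =
        (\<Prod>i\<in>V. (if i = a then x i else 1) * x i ^ count_list w i)"
    by (intro prod.cong) auto
  also have "\<dots> = x a * (\<Prod>i\<in>V. x i ^ count_list w i)"
    using Cons.hyps assms(1) by (auto simp: prod.distrib)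
  finally show ?case using Cons by (simp add: word_weight_def)
qed (simp add: word_weight_def)

lemma class_weight_count:
  assumes "finite V" "t \<in> traces V E"
  shows "class_weight x t = (\<Prod>i\<in>V. x i ^ class_count t i)"
proof -
  obtain w where w: "w \<in> lists V" "t = word_class V E w" using assms(2) by (rule traces_cases)
  show ?thesis
    unfolding w(2) class_weight_word_class[OF w(1)] class_count_word_class[OF w(1)]
    by (rule word_weight_count[OF assms(1) w(1)])
qed

lemma class_weight_clique_mult:
  assumes "finite V" "C \<in> cliques V (compl_edges V E)" "t \<in> traces V E"
  shows "class_weight x (clique_mult V E C t) = (\<Prod>i\<in>C. x i) * class_weight x t"
proof -
  have "clique_mult V E C t \<in> traces V E"
    using image_clique_mult[OF assms(1,2)] assms(3) by blast
  then have "class_weight x (clique_mult V E C t) =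
      (\<Prod>i\<in>V. x i ^ indicator C i) * class_weight x t"
    by (simp add: class_weight_count[OF assms(1)] class_count_clique_mult[OF assms]
        power_add prod.distrib class_weight_count[OF assms(1,3)])
  also have "(\<Prod>i\<in>V. x i ^ indicator C i) = (\<Prod>i\<in>C. x i)"
    using clique_subset[OF assms(2)]
    by (intro prod.mono_neutral_cong_right assms(1)) auto
  finally show ?thesis .
qed

definition class_length :: "'a set \<Rightarrow> 'a list set \<Rightarrow> nat" where
  "class_length V t = sum (class_count t) V"

lemma class_length_clique_mult:
  assumes "finite V" "C \<in> cliques V F" "t \<in> traces V E"
  shows "class_length V (clique_mult V E C t) = card C + class_length V t"
proof -
  have "sum (indicator C) V = card C"
    using sum_indicator_eq_card[OF assms(1), of C] clique_subset[OF assms(2)] by (simp add: Int_absorb1)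
  then show ?thesis
    by (simp add: class_length_def class_count_clique_mult[OF assms] sum.distrib)
qed

lemma finite_class_length_le:
  assumes "finite V"
  shows "finite {t \<in> traces V E. class_length V t \<le> k}"
proof (rule finite_subset)
  show "{t \<in> traces V E. class_length V t \<le> k} \<subseteq> word_class V E ` {w. set w \<subseteq> V \<and> length w \<le> k}"
  proof
    fix t assume "t \<in> {t \<in> traces V E. class_length V t \<le> k}"
    then have t: "t \<in> traces V E" "class_length V t \<le> k" by auto
    obtain w where w: "w \<in> lists V" "t = word_class V E w" using t(1) by (rule traces_cases)
    have "sum (count_list w) V = length w"
      using w(1) assms by (intro sum_count_set) auto
    then have "length w \<le> k"
      using t w by (simp add: class_length_def class_count_word_class)
    then show "t \<in> word_class V E ` {w. set w \<subseteq> V \<and> length w \<le> k}" using w by auto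
  qed
qed (use finite_lists_length_le[OF assms] in auto)

lemma finite_class_count_eq:
  assumes "finite V"
  shows "finite {t \<in> traces V E. class_count t = n}"
  by (rule finite_subset[OF _ finite_class_length_le[OF assms, of E "sum n V"]])
    (auto simp: class_length_def)

lemma finite_class_length_eq:
  assumes "finite V"
  shows "finite {t \<in> traces V E. class_length V t = k}"
  by (rule finite_subset[OF _ finite_class_length_le[OF assms, of E k]]) auto

lemma infsum_of_bool:
  fixes g :: "'b \<Rightarrow> real"
  assumes "finite {t \<in> T. P t}"
  shows "(\<Sum>\<^sub>\<infinity>t\<in>T. of_bool (P t) * g t) = (\<Sum>t | t \<in> T \<and> P t. g t)"
    and "(\<lambda>t. of_bool (P t) * g t) summable_on T"
proof -
  have "(\<Sum>\<^sub>\<infinity>t\<in>T. of_bool (P t) * g t) = (\<Sum>\<^sub>\<infinity>t\<in>{t \<in> T. P t}. g t)"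
    by (rule infsum_cong_neutral) auto
  then show "(\<Sum>\<^sub>\<infinity>t\<in>T. of_bool (P t) * g t) = (\<Sum>t | t \<in> T \<and> P t. g t)"
    using assms by simp
  show "(\<lambda>t. of_bool (P t) * g t) summable_on T"
    by (rule finite_nonzero_values_imp_summable_on, rule finite_subset[OF _ assms]) auto
qed

definition trace_number :: "'a set \<Rightarrow> 'a set set \<Rightarrow> ('a \<Rightarrow> nat) \<Rightarrow> real" where
  "trace_number V E n = real (card {t \<in> traces V E. class_count t = n})"

text \<open>Inversion over all cliques, applied to the indicator function of the traces with letter count \<open>n\<close>:
multiplication by \<open>C\<close> adds the indicator of \<open>C\<close> to the letter counts, so that the sums over \<open>t\<close>
are the shifted counts in the product of the two series.\<close>

lemma Delta_series_times_trace_number: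
  assumes V: "finite V" and n: "n \<in> exponents V"
  shows "mfps_mult (Delta_series V E) (trace_number V E) n = mfps_one n"
proof -
  let ?K = "cliques V (compl_edges V E)" and ?T = "traces V E"
  let ?f = "\<lambda>s. of_bool (class_count s = n) * (1::real)"
  have f: "?f summable_on ?T" by (rule infsum_of_bool(2)[OF finite_class_count_eq[OF V]])
  have shift: "(\<Sum>\<^sub>\<infinity>t\<in>?T. ?f (clique_mult V E C t)) =
      (if indicator C \<le> n then trace_number V E (\<lambda>i. n i - indicator C i) else 0)"
    if C: "C \<in> ?K" for C
  proof (cases "indicator C \<le> n")
    case True
    have "class_count (clique_mult V E C t) = n \<longleftrightarrow> class_count t = (\<lambda>i. n i - indicator C i)"
      if "t \<in> ?T" for t
    proof -
      have "indicator C i + class_count t i = n i \<longleftrightarrow> class_count t i = n i - indicator C i" for i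
        using le_funD[OF True, of i] by auto
      then show ?thesis
        by (simp add: class_count_clique_mult[OF V C that] fun_eq_iff)
    qed
    then have "(\<Sum>\<^sub>\<infinity>t\<in>?T. ?f (clique_mult V E C t)) =
        (\<Sum>\<^sub>\<infinity>t\<in>?T. of_bool (class_count t = (\<lambda>i. n i - indicator C i)) * (1::real))"
      by (intro infsum_cong) simp
    then show ?thesis
      using True by (simp add: infsum_of_bool(1)[OF finite_class_count_eq[OF V], where g = "\<lambda>_. 1", simplified]
          trace_number_def)
  next
    case False
    then obtain i where i: "\<not> indicator C i \<le> n i" by (auto simp: le_fun_def)
    have "class_count (clique_mult V E C t) \<noteq> n" if "t \<in> ?T" for t
    proof
      assume "class_count (clique_mult V E C t) = n"
      then have "indicator C i + class_count t i = n i"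
        using class_count_clique_mult[OF V C that] by metis
      then show False using i by simp
    qed
    then have "(\<Sum>\<^sub>\<infinity>t\<in>?T. ?f (clique_mult V E C t)) = (\<Sum>\<^sub>\<infinity>t\<in>?T. 0)"
      by (intro infsum_cong) simp
    then show ?thesis using False by simp
  qed
  have "mfps_mult (Delta_series V E) (trace_number V E) n =
      (\<Sum>k | k \<le> n. \<Sum>C\<in>?K. if k = indicator C
         then (-1) ^ card C * trace_number V E (\<lambda>i. n i - k i) else 0)"
    unfolding mfps_mult_def Delta_series_def sum_distrib_right mfps_monom_def
    by (intro sum.cong refl) auto
  also have "\<dots> = (\<Sum>C\<in>?K. \<Sum>k | k \<le> n. if k = indicator C
         then (-1) ^ card C * trace_number V E (\<lambda>i. n i - k i) else 0)"
    by (rule sum.swap)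
  also have "\<dots> = (\<Sum>C\<in>?K. (-1) ^ card C * (\<Sum>\<^sub>\<infinity>t\<in>?T. ?f (clique_mult V E C t)))"
    by (intro sum.cong refl) (simp add: shift finite_le_exponents[OF V n] del: mult_1_right)
  also have "\<dots> = ?f (word_class V E [])"
    by (rule clique_inversion_full[OF V f])
  also have "\<dots> = mfps_one n"
    using class_count_word_class[of "[]" V E] by (auto simp: mfps_one_def mfps_monom_def fun_eq_iff)
  finally show ?thesis .
qed

theorem graph_multinomial_eq_trace_number:
  assumes V: "finite V" and n: "n \<in> exponents V"
  shows "graph_multinomial V E n = trace_number V E n"
proof -
  let ?g = "\<lambda>n. if n \<in> exponents V then trace_number V E n else 0"
  have "mfps_mult (Delta_series V E) ?g n = mfps_one n" if n: "n \<in> exponents V" for n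
  proof -
    have "(\<lambda>i. n i - k i) \<in> exponents V" for k :: "'a \<Rightarrow> nat"
      using n by (simp add: exponents_def)
    then show ?thesis
      using Delta_series_times_trace_number[OF V n] by (simp add: mfps_mult_def)
  qed
  then have "mfps_inverse V (Delta_series V E) = ?g"
    unfolding mfps_inverse_def
    by (intro the1_equality[OF mfps_inverse_ex1[OF V]]) (simp_all add: Delta_series_0[OF V])
  then show ?thesis using n by (simp add: graph_multinomial_def)
qed

section \<open>The total weight of all traces\<close>

text \<open>The same inversion applied to the weights, which are multiplicative.\<close>

theorem Delta_times_total_weight:
  assumes V: "finite V" and x: "class_weight x summable_on traces V E"
  shows "Delta V E x * (\<Sum>\<^sub>\<infinity>t\<in>traces V E. class_weight x t) = 1"
proof -
  let ?K = "cliques V (compl_edges V E)" and ?T = "traces V E"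
  have "Delta V E x * (\<Sum>\<^sub>\<infinity>t\<in>?T. class_weight x t) =
      (\<Sum>C\<in>?K. (-1) ^ card C * (\<Sum>\<^sub>\<infinity>t\<in>?T. class_weight x (clique_mult V E C t)))"
    unfolding Delta_def sum_distrib_right
  proof (rule sum.cong[OF refl])
    fix C assume C: "C \<in> ?K"
    have "(\<Sum>\<^sub>\<infinity>t\<in>?T. class_weight x (clique_mult V E C t)) =
        (\<Sum>\<^sub>\<infinity>t\<in>?T. (\<Prod>i\<in>C. x i) * class_weight x t)"
      by (intro infsum_cong class_weight_clique_mult[OF V C])
    then show "(-1) ^ card C * (\<Prod>i\<in>C. x i) * (\<Sum>\<^sub>\<infinity>t\<in>?T. class_weight x t) =
        (-1) ^ card C * (\<Sum>\<^sub>\<infinity>t\<in>?T. class_weight x (clique_mult V E C t))"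
      by (simp add: infsum_cmult_right')
  qed
  also have "\<dots> = class_weight x (word_class V E [])"
    by (rule clique_inversion_full[OF V x])
  also have "\<dots> = 1"
    using class_weight_word_class[of "[]" V x E] by (simp add: word_weight_def)
  finally show ?thesis .
qed

section \<open>Splitting cliques at a vertex\<close>

lemma cliques_compl_edges:
  assumes "A \<subseteq> V"
  shows "cliques A (compl_edges A E) = cliques A (compl_edges V E)"
proof -
  have "{u, v} \<in> compl_edges A E \<longleftrightarrow> {u, v} \<in> compl_edges V E" if "u \<in> A" "v \<in> A" for u v
    using that assms by (auto simp: compl_edges_def simple_edges_def doubleton_eq_iff)
  then show ?thesis unfolding cliques_def by blast
qed

lemma Delta_induced_edges: "Delta A (induced_edges E A) x = Delta A E x"
proof -
  have "compl_edges A (induced_edges E A) = compl_edges A E"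
    by (auto simp: compl_edges_def simple_edges_def induced_edges_def)
  then show ?thesis by (simp add: Delta_def)
qed

definition nonneighbours :: "'a set \<Rightarrow> 'a set set \<Rightarrow> 'a \<Rightarrow> 'a set" where
  "nonneighbours V E v = {u. {u, v} \<in> compl_edges V E}"

lemma nonneighbours_subset: "nonneighbours (insert v W) E v \<subseteq> W"
  by (auto simp: nonneighbours_def compl_edges_def simple_edges_def doubleton_eq_iff)

text \<open>A clique that contains \<open>v\<close> consists of \<open>v\<close> and a clique among the vertices that commute with \<open>v\<close>.\<close>

lemma sum_cliques_insert:
  fixes g :: "'a set \<Rightarrow> 'b :: comm_monoid_add" and E :: "'a set set"
  assumes W: "finite W" "v \<notin> W"
  defines "N \<equiv> nonneighbours (insert v W) E v"
  shows "(\<Sum>C\<in>cliques (insert v W) (compl_edges (insert v W) E). g C) =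
         (\<Sum>C\<in>cliques W (compl_edges W E). g C) + (\<Sum>C\<in>cliques N (compl_edges N E). g (insert v C))"
proof -
  let ?F = "compl_edges (insert v W) E"
  have N: "N \<subseteq> W"
    unfolding N_def by (rule nonneighbours_subset)
  then have finN: "finite N"
    using W(1) by (rule finite_subset)
  have vN: "v \<notin> C" if "C \<in> cliques N ?F" for C
    using that N W by (auto simp: cliques_def)
  have eq: "cliques (insert v W) ?F = cliques W ?F \<union> insert v ` cliques N ?F"
  proof (intro equalityI subsetI)
    fix C assume C: "C \<in> cliques (insert v W) ?F"
    show "C \<in> cliques W ?F \<union> insert v ` cliques N ?F"
    proof (cases "v \<in> C")
      case True
      have "C - {v} \<in> cliques N ?F"
        using C True by (auto simp: cliques_def N_def nonneighbours_def)
      moreover have "C = insert v (C - {v})" using True by auto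
      ultimately show ?thesis by blast
    qed (use C in \<open>auto simp: cliques_def\<close>)
  next
    fix C assume "C \<in> cliques W ?F \<union> insert v ` cliques N ?F"
    then show "C \<in> cliques (insert v W) ?F"
    proof
      assume "C \<in> insert v ` cliques N ?F"
      then obtain D where D: "C = insert v D" "D \<in> cliques N ?F" by blast
      have Dv: "{u, v} \<in> ?F" "{v, u} \<in> ?F" if "u \<in> D" for u
        using D(2) that by (auto simp: cliques_def N_def nonneighbours_def insert_commute)
      have "D \<subseteq> W" "\<forall>a\<in>D. \<forall>b\<in>D. a \<noteq> b \<longrightarrow> {a, b} \<in> ?F"
        using D(2) N by (auto simp: cliques_def)
      then show ?thesis
        unfolding D(1) cliques_def using Dv by auto
    qed (auto simp: cliques_def)
  qed
  have disj: "cliques W ?F \<inter> insert v ` cliques N ?F = {}"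
    using W(2) by (auto simp: cliques_def)
  have inj: "inj_on (insert v) (cliques N ?F)"
    using vN by (auto intro!: inj_onI dest: insert_ident)
  have "(\<Sum>C\<in>cliques (insert v W) ?F. g C) =
      (\<Sum>C\<in>cliques W ?F. g C) + (\<Sum>C\<in>cliques N ?F. g (insert v C))"
    unfolding eq
    by (subst sum.union_disjoint)
      (use W(1) finN disj inj in \<open>simp_all add: sum.reindex finite_cliques\<close>)
  then show ?thesis
    using cliques_compl_edges[of W "insert v W" E]
      cliques_compl_edges[of N "insert v W" E] N
    by (simp add: subset_insertI subset_insertI2)
qed

section \<open>Convergence\<close>

text \<open>To decide convergence it is enough to grade traces by length. The clique polynomial and the weight
series of traces are therefore considered along the ray through \<open>x\<close>, as power series in one variable;
evaluated at 1 they become \<open>Delta V E x\<close> and the total weight.\<close>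

definition clique_fps :: "'a set \<Rightarrow> 'a set set \<Rightarrow> ('a \<Rightarrow> real) \<Rightarrow> real fps" where
  "clique_fps V E x = (\<Sum>C\<in>cliques V (compl_edges V E).
     fps_const ((-1) ^ card C * (\<Prod>i\<in>C. x i)) * fps_X ^ card C)"

definition trace_fps :: "'a set \<Rightarrow> 'a set set \<Rightarrow> ('a \<Rightarrow> real) \<Rightarrow> real fps" where
  "trace_fps V E x = Abs_fps (\<lambda>k. \<Sum>t | t \<in> traces V E \<and> class_length V t = k. class_weight x t)"

lemma insert_clique:
  assumes "finite W" "v \<notin> W" "C \<in> cliques (nonneighbours (insert v W) E v) F"
  shows "finite C" "v \<notin> C"
proof -
  have "C \<subseteq> W"
    using clique_subset[OF assms(3)] nonneighbours_subset by (rule subset_trans)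
  then show "finite C" "v \<notin> C" using assms(1,2) finite_subset by auto
qed

lemma Delta_insert:
  assumes "finite W" "v \<notin> W"
  shows "Delta (insert v W) E x = Delta W E x - x v * Delta (nonneighbours (insert v W) E v) E x"
  unfolding Delta_def sum_cliques_insert[OF assms] sum_distrib_left
    diff_conv_add_uminus sum_negf[symmetric]
  using insert_clique[OF assms] by (intro arg_cong2[of _ _ _ _ "(+)"] sum.cong refl) (simp add: mult_ac)

lemma clique_fps_insert:
  assumes "finite W" "v \<notin> W"
  shows "clique_fps (insert v W) E x =
    clique_fps W E x - fps_const (x v) * fps_X * clique_fps (nonneighbours (insert v W) E v) E x"
proof -
  have "fps_const ((-1) ^ card (insert v C) * (\<Prod>i\<in>insert v C. x i)) * fps_X ^ card (insert v C) =
      - (fps_const (x v) * fps_X * (fps_const ((-1) ^ card C * (\<Prod>i\<in>C. x i)) * fps_X ^ card C))"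
    if "C \<in> cliques (nonneighbours (insert v W) E v) F" for C F
  proof -
    have "fps_const ((-1) ^ card (insert v C) * (\<Prod>i\<in>insert v C. x i)) =
        - (fps_const (x v) * fps_const ((-1) ^ card C * (\<Prod>i\<in>C. x i)))"
      using insert_clique[OF assms that] by (simp add: mult_ac)
    then show ?thesis using insert_clique[OF assms that] by (simp add: mult_ac)
  qed
  then show ?thesis
    unfolding clique_fps_def sum_cliques_insert[OF assms] sum_distrib_left diff_conv_add_uminus
      sum_negf[symmetric]
    by (intro arg_cong2[of _ _ _ _ "(+)"] sum.cong refl)
qed

lemma clique_fps_sums:
  assumes V: "finite V"
  shows "fps_nth (clique_fps V E x) sums Delta V E x"
    and "summable (\<lambda>k. norm (fps_nth (clique_fps V E x) k))"
proof -
  let ?K = "cliques V (compl_edges V E)"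
  have nth: "fps_nth (clique_fps V E x) k =
      (\<Sum>C\<in>?K. if k = card C then (-1) ^ card C * (\<Prod>i\<in>C. x i) else 0)" for k
    unfolding clique_fps_def by (simp add: fps_sum_nth fps_X_power_iff if_distrib cong: if_cong)
  have "(\<lambda>k. \<Sum>C\<in>?K. if k = card C then (-1) ^ card C * (\<Prod>i\<in>C. x i) else 0) sums
      (\<Sum>C\<in>?K. (-1) ^ card C * (\<Prod>i\<in>C. x i))"
    by (intro sums_sum) (rule sums_single)
  then show "fps_nth (clique_fps V E x) sums Delta V E x"
    unfolding Delta_def nth .
  have "fps_nth (clique_fps V E x) k = 0" if "k > card V" for k
  proof -
    have "card C \<noteq> k" if "C \<in> ?K" for C
      using card_mono[OF V clique_subset[OF that]] \<open>k > card V\<close> by simp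
    then show ?thesis unfolding nth by (intro sum.neutral) auto
  qed
  then show "summable (\<lambda>k. norm (fps_nth (clique_fps V E x) k))"
    by (intro summable_finite[of "{..card V}"]) auto
qed

text \<open>The coefficient of degree \<open>k\<close> in the form to which inversion over cliques applies, with \<open>f\<close>
being the weight restricted to traces of length \<open>k\<close>.\<close>

lemma clique_fps_times_trace_fps:
  assumes V: "finite V" and A: "A \<subseteq> V"
  shows "fps_nth (clique_fps A E x * trace_fps V E x) k =
    (\<Sum>C\<in>cliques A (compl_edges V E). (-1) ^ card C * (\<Sum>\<^sub>\<infinity>t\<in>traces V E.
       of_bool (class_length V (clique_mult V E C t) = k) * class_weight x (clique_mult V E C t)))"
proof -
  let ?T = "traces V E"
  have "(\<Prod>i\<in>C. x i) * (if k < card C then 0 else fps_nth (trace_fps V E x) (k - card C)) =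
      (\<Sum>\<^sub>\<infinity>t\<in>?T. of_bool (class_length V (clique_mult V E C t) = k) * class_weight x (clique_mult V E C t))"
    if "C \<in> cliques A (compl_edges V E)" for C
  proof -
    have C: "C \<in> cliques V (compl_edges V E)" using that A by (auto simp: cliques_def)
    have "(\<Sum>\<^sub>\<infinity>t\<in>?T. of_bool (class_length V (clique_mult V E C t) = k) * class_weight x (clique_mult V E C t)) =
        (\<Sum>\<^sub>\<infinity>t\<in>?T. (\<Prod>i\<in>C. x i) * (of_bool (card C + class_length V t = k) * class_weight x t))"
      by (intro infsum_cong) (simp add: class_length_clique_mult[OF V C] class_weight_clique_mult[OF V C])
    also have "\<dots> = (\<Prod>i\<in>C. x i) * (\<Sum>\<^sub>\<infinity>t\<in>?T. of_bool (card C + class_length V t = k) * class_weight x t)"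
      by (rule infsum_cmult_right')
    also have "(\<Sum>\<^sub>\<infinity>t\<in>?T. of_bool (card C + class_length V t = k) * class_weight x t) =
        (if k < card C then 0 else fps_nth (trace_fps V E x) (k - card C))"
    proof (cases "k < card C")
      case False
      then have "card C + class_length V t = k \<longleftrightarrow> class_length V t = k - card C" for t
        by auto
      then show ?thesis
        using False by (simp add: trace_fps_def infsum_of_bool(1)[OF finite_class_length_eq[OF V]])
    qed simp
    finally show ?thesis by simp
  qed
  then show ?thesis
    unfolding clique_fps_def sum_distrib_right fps_sum_nth cliques_compl_edges[OF A]
    by (intro sum.cong refl) (simp add: mult.assoc fps_X_power_mult_nth)
qed

lemma clique_fps_times_trace_fps_eq_1:
  assumes V: "finite V"
  shows "clique_fps V E x * trace_fps V E x = 1"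
proof (rule fps_ext)
  fix k
  show "fps_nth (clique_fps V E x * trace_fps V E x) k = fps_nth 1 k"
    unfolding clique_fps_times_trace_fps[OF V order_refl]
    using clique_inversion_full[OF V infsum_of_bool(2)[OF finite_class_length_eq[OF V]],
        of E k "class_weight x"]
      class_weight_word_class[of "[]" V x E] class_count_word_class[of "[]" V E]
    by (simp add: class_length_def word_weight_def)
qed

lemma class_weight_nonneg:
  assumes "finite V" "\<forall>i\<in>V. 0 < x i" "t \<in> traces V E"
  shows "0 \<le> class_weight x t"
  using assms by (simp add: class_weight_count prod_nonneg less_imp_le)

text \<open>The product is the weight series of the traces over \<open>V\<close> without an initial letter in \<open>A\<close>, although
the first factor has coefficients of both signs.\<close>

lemma clique_fps_times_trace_fps_nonneg:
  assumes V: "finite V" and A: "A \<subseteq> V" and x: "\<forall>i\<in>V. 0 < x i"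
  shows "0 \<le> fps_nth (clique_fps A E x * trace_fps V E x) k"
proof -
  have "fps_nth (clique_fps A E x * trace_fps V E x) k =
      (\<Sum>\<^sub>\<infinity>t\<in>traces V E. of_bool (initials t \<inter> A = {}) * (of_bool (class_length V t = k) * class_weight x t))"
    unfolding clique_fps_times_trace_fps[OF V A]
    by (rule clique_inversion[OF V A infsum_of_bool(2)[OF finite_class_length_eq[OF V]]])
  also have "\<dots> \<ge> 0"
    using class_weight_nonneg[OF V x] by (intro infsum_nonneg) simp
  finally show ?thesis .
qed

lemma partial_sum_Cauchy_product_le:
  fixes a b :: "nat \<Rightarrow> real"
  assumes "\<And>i. 0 \<le> a i" "\<And>i. 0 \<le> b i"
  shows "(\<Sum>k<n. \<Sum>i\<le>k. a i * b (k - i)) \<le> (\<Sum>i<n. a i) * (\<Sum>i<n. b i)"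
proof -
  have "(\<Sum>k<n. \<Sum>i\<le>k. a i * b (k - i)) = (\<Sum>(i, j)\<in>{(i, j). i + j < n}. a i * b j)"
    by (rule sum.triangle_reindex[symmetric])
  also have "\<dots> \<le> (\<Sum>(i, j)\<in>{..<n} \<times> {..<n}. a i * b j)"
    using assms by (intro sum_mono2) auto
  also have "\<dots> = (\<Sum>i<n. a i) * (\<Sum>i<n. b i)"
    by (simp add: sum_product sum.cartesian_product)
  finally show ?thesis .
qed

text \<open>The hypothesis is the renewal equation \<open>z = b + c T p z\<close> for power series in \<open>T\<close>. For
nonnegative coefficients the partial sums of \<open>z\<close> satisfy \<open>S \<le> B + c P S\<close>, where
\<open>B\<close> and \<open>P\<close> are the sums of \<open>b\<close> and \<open>p\<close>, and \<open>c P < 1\<close> turns this into a bound.\<close>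

lemma summable_renewal:
  fixes z b p :: "nat \<Rightarrow> real"
  assumes nn: "\<And>k. 0 \<le> z k" "\<And>k. 0 \<le> b k" "\<And>k. 0 \<le> p k" and c: "0 \<le> c"
    and b: "summable b" and p: "summable p" and less: "c * suminf p < 1"
    and z0: "z 0 = b 0" and zS: "\<And>k. z (Suc k) = b (Suc k) + c * (\<Sum>i\<le>k. p i * z (k - i))"
  shows "summable z"
proof (rule summableI_nonneg_bounded)
  fix n
  let ?h = "\<lambda>k. \<Sum>i\<le>k. p i * z (k - i)"
  have z: "sum z {..<n} \<le> sum b {..<n} + c * sum ?h {..<n}" for n
  proof (cases n)
    case (Suc m)
    have "sum z {..<n} = sum b {..<n} + c * sum ?h {..<m}"
      unfolding Suc by (simp add: sum.lessThan_Suc_shift z0 zS sum.distrib sum_distrib_left del: sum.lessThan_Suc)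
    also have "\<dots> \<le> sum b {..<n} + c * sum ?h {..<n}"
      using nn c Suc by (intro add_left_mono mult_left_mono sum_mono2) (auto intro!: sum_nonneg)
    finally show ?thesis .
  qed simp
  have "sum z {..<n} \<le> sum b {..<n} + c * (sum p {..<n} * sum z {..<n})"
    using z[of n] mult_left_mono[OF partial_sum_Cauchy_product_le[of p z n, OF nn(3,1)] c] by linarith
  also have "\<dots> \<le> suminf b + c * (suminf p * sum z {..<n})"
    using nn c b p by (intro add_mono mult_left_mono mult_right_mono sum_le_suminf sum_nonneg) auto
  finally have "sum z {..<n} * (1 - c * suminf p) \<le> suminf b" by (simp add: algebra_simps)
  then show "sum z {..<n} \<le> suminf b / (1 - c * suminf p)"
    using less by (simp add: pos_le_divide_eq)
qed (use nn in auto)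

text \<open>Induction on the vertices. Let \<open>V\<close> be \<open>W\<close> with a new vertex \<open>v\<close>, let \<open>N\<close> be the vertices that commute
with \<open>v\<close>, and write \<open>D\<close> and \<open>z\<close> for the clique and trace series. From
\<open>D\<^sub>V = D\<^sub>W - x\<^sub>v T D\<^sub>N\<close> and \<open>D z = 1\<close> on both \<open>V\<close> and \<open>W\<close> one gets
\<open>z\<^sub>V = z\<^sub>W + x\<^sub>v T (D\<^sub>N z\<^sub>W) z\<^sub>V\<close>, a renewal equation whose kernel \<open>D\<^sub>N z\<^sub>W\<close> has nonnegative
coefficients. Its total mass \<open>x\<^sub>v \<Delta>\<^sub>N / \<Delta>\<^sub>W\<close> is less than 1 because
\<open>\<Delta>\<^sub>V = \<Delta>\<^sub>W - x\<^sub>v \<Delta>\<^sub>N\<close> is positive; positivity of \<open>\<Delta>\<close> on all subsets keeps the induction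
going.\<close>

lemma summable_trace_fps:
  assumes "finite V" "\<forall>i\<in>V. 0 < x i" "\<forall>A\<subseteq>V. 0 < Delta A E x"
  shows "summable (fps_nth (trace_fps V E x))"
  using assms
proof (induction V rule: finite_induct)
  case empty
  have "clique_fps {} E x = 1"
  proof -
    have "cliques {} (compl_edges {} E) = {{}}" by (auto simp: cliques_def)
    then show ?thesis by (simp add: clique_fps_def)
  qed
  then have "trace_fps {} E x = 1"
    using clique_fps_times_trace_fps_eq_1[of "{}" E x] by simp
  then show ?case by (simp add: summable_finite[of "{0}"])
next
  case (insert v W)
  let ?V = "insert v W"
  let ?N = "nonneighbours ?V E v"
  let ?DV = "clique_fps ?V E x" and ?DW = "clique_fps W E x" and ?DN = "clique_fps ?N E x"
  let ?zV = "trace_fps ?V E x" and ?zW = "trace_fps W E x"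
  have N: "?N \<subseteq> W" by (rule nonneighbours_subset)
  have finN: "finite ?N" using N insert.hyps(1) finite_subset by blast
  have nnz: "0 \<le> fps_nth (trace_fps U E x) k" if "finite U" "\<forall>i\<in>U. 0 < x i" for U k
    using class_weight_nonneg[OF that] by (auto simp: trace_fps_def intro!: sum_nonneg)
  have "\<forall>A\<subseteq>W. 0 < Delta A E x" using insert.prems(2) by (simp add: subset_insertI2)
  then have sW: "summable (fps_nth ?zW)" using insert by auto
  have nW: "summable (\<lambda>k. norm (fps_nth ?zW k))"
    using sW nnz[of W] insert by simp
  have prod: "fps_nth (clique_fps A E x * ?zW) sums (Delta A E x * suminf (fps_nth ?zW))"
    if "finite A" for A
  proof -
    have "fps_nth (clique_fps A E x * ?zW) =
        (\<lambda>k. \<Sum>i\<le>k. fps_nth (clique_fps A E x) i * fps_nth ?zW (k - i))"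
      by (rule ext) (simp add: fps_mult_nth atLeast0AtMost)
    then show ?thesis
      using Cauchy_product_sums[OF clique_fps_sums(2)[OF that, of E x] nW]
      by (simp add: sums_unique[OF clique_fps_sums(1)[OF that], symmetric])
  qed
  have "fps_nth (1 :: real fps) = (\<lambda>k. if k = 0 then 1 else 0)" by (rule ext) simp
  then have "fps_nth (1 :: real fps) sums 1"
    using sums_single[of 0 "\<lambda>_. 1::real"] by simp
  then have one: "Delta W E x * suminf (fps_nth ?zW) = 1"
    using prod[OF insert.hyps(1)] sums_unique2
    unfolding clique_fps_times_trace_fps_eq_1[OF insert.hyps(1)] by metis
  let ?p = "?DN * ?zW"
  have p: "summable (fps_nth ?p)" "suminf (fps_nth ?p) = Delta ?N E x * suminf (fps_nth ?zW)"
    using prod[OF finN] by (auto simp: sums_iff)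
  have DW: "0 < Delta W E x" using insert.prems(2) by blast
  have "0 < Delta ?V E x" using insert.prems(2) by blast
  then have lt: "x v * Delta ?N E x < Delta W E x"
    unfolding Delta_insert[OF insert.hyps] by simp
  have Z: "suminf (fps_nth ?zW) = 1 / Delta W E x"
    using one DW by (simp add: field_simps)
  have less: "x v * suminf (fps_nth ?p) < 1"
    unfolding p(2) Z using DW lt by simp
  have "?zV = ?zV * (?DW * ?zW)"
    by (simp add: clique_fps_times_trace_fps_eq_1[OF insert.hyps(1)])
  also have "?DW = ?DV + fps_const (x v) * fps_X * ?DN"
    by (simp add: clique_fps_insert[OF insert.hyps])
  also have "?zV * ((?DV + fps_const (x v) * fps_X * ?DN) * ?zW) =
      (?DV * ?zV) * ?zW + fps_X * (fps_const (x v) * (?p * ?zV))"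
    by (simp add: algebra_simps)
  also have "?DV * ?zV = 1"
    using insert.hyps(1) by (intro clique_fps_times_trace_fps_eq_1) simp
  finally have rec: "?zV = ?zW + fps_X * (fps_const (x v) * (?p * ?zV))" by simp
  have rec': "fps_nth ?zV k = fps_nth (?zW + fps_X * (fps_const (x v) * (?p * ?zV))) k" for k
    using rec by simp
  show ?case
  proof (rule summable_renewal[OF _ _ _ _ sW p(1) less])
    show "0 \<le> fps_nth ?zV k" "0 \<le> fps_nth ?zW k" for k
      using nnz insert by auto
    show "0 \<le> fps_nth ?p k" for k
      using insert by (intro clique_fps_times_trace_fps_nonneg N) auto
    show "0 \<le> x v" using insert by auto
    show "fps_nth ?zV 0 = fps_nth ?zW 0" by (subst rec') simp
    show "fps_nth ?zV (Suc k) = fps_nth ?zW (Suc k) +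
        x v * (\<Sum>i\<le>k. fps_nth ?p i * fps_nth ?zV (k - i))" for k
      by (subst rec') (simp add: fps_mult_nth[of ?p ?zV] atLeast0AtMost)
  qed
qed

text \<open>A finite set of traces has bounded length, so its weight is at most a partial sum of the length
series.\<close>

theorem class_weight_summable:
  assumes V: "finite V" and x: "\<forall>i\<in>V. 0 < x i" and D: "\<forall>A\<subseteq>V. 0 < Delta A E x"
  shows "class_weight x summable_on traces V E"
proof (rule nonneg_bdd_above_summable_on)
  show nn: "0 \<le> class_weight x t" if "t \<in> traces V E" for t
    by (rule class_weight_nonneg[OF V x that])
  show "bdd_above (sum (class_weight x) ` {F. F \<subseteq> traces V E \<and> finite F})"
  proof (rule bdd_aboveI2)
    fix F assume "F \<in> {F. F \<subseteq> traces V E \<and> finite F}"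
    then have F: "F \<subseteq> traces V E" "finite F" by auto
    let ?n = "Suc (Max (class_length V ` F))"
    have "class_length V ` F \<subseteq> {..<?n}"
      using F(2) by (auto simp: less_Suc_eq_le)
    then have "sum (class_weight x) F = (\<Sum>k<?n. \<Sum>t | t \<in> F \<and> class_length V t = k. class_weight x t)"
      using F(2) by (intro sum.group[symmetric]) auto
    also have "\<dots> \<le> (\<Sum>k<?n. fps_nth (trace_fps V E x) k)"
    proof (rule sum_mono)
      fix k
      show "(\<Sum>t | t \<in> F \<and> class_length V t = k. class_weight x t) \<le> fps_nth (trace_fps V E x) k"
        unfolding trace_fps_def fps_nth_Abs_fps using F nn
        by (intro sum_mono2 finite_class_length_eq[OF V]) auto
    qed
    also have "\<dots> \<le> suminf (fps_nth (trace_fps V E x))"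
      using nn by (intro sum_le_suminf summable_trace_fps V x D) (auto simp: trace_fps_def intro!: sum_nonneg)
    finally show "sum (class_weight x) F \<le> suminf (fps_nth (trace_fps V E x))" .
  qed
qed

section \<open>The distribution of the letter counts\<close>

text \<open>All traces with letter count \<open>n\<close> have the same weight \<open>x\<^sup>n\<close>, hence the same probability
\<open>x\<^sup>n \<Delta>\<^sub>G(x)\<close>; it remains to count them.\<close>

theorem theorem4p2:
  fixes V :: "'a set" and E :: "'a set set" and x :: "'a \<Rightarrow> real"
    and M :: "'b measure" and l :: "'b \<Rightarrow> 'a list set"
  assumes "finite_simple_graph V E"
    and "x \<in> M_set V E"
  shows "class_weight x summable_on carrier (free_quotient_monoid V E) \<and>
    (prob_space M \<longrightarrow>
     l \<in> measurable M (count_space (carrier (free_quotient_monoid V E))) \<longrightarrow>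
     (\<forall>w\<in>lists V.
        \<P>(\<omega> in M. l \<omega> = word_class V E w) =
          word_weight x w / (\<Sum>\<^sub>\<infinity>c\<in>carrier (free_quotient_monoid V E). class_weight x c)) \<longrightarrow>
     (\<forall>n\<in>exponents V.
        \<P>(\<omega> in M. class_count (l \<omega>) = n) =
          graph_multinomial V E n * (\<Prod>i\<in>V. x i ^ n i) * Delta V E x))"
proof (intro conjI impI ballI)
  have V: "finite V" using assms(1) by (simp add: finite_simple_graph_def)
  have x: "\<forall>i\<in>V. 0 < x i" "\<forall>A\<subseteq>V. 0 < Delta A E x"
    using assms(2) by (simp_all add: M_set_def Delta_induced_edges)
  show summable: "class_weight x summable_on carrier (free_quotient_monoid V E)"
    by (rule class_weight_summable[OF V x])
  let ?Z = "\<Sum>\<^sub>\<infinity>c\<in>traces V E. class_weight x c"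
  have "Delta V E x * ?Z = 1" by (rule Delta_times_total_weight[OF V summable])
  then have Z: "1 / ?Z = Delta V E x" by (metis mult_zero_right nonzero_eq_divide_eq zero_neq_one)
  assume "prob_space M"
    and l: "l \<in> measurable M (count_space (carrier (free_quotient_monoid V E)))"
    and dist: "\<forall>w\<in>lists V. \<P>(\<omega> in M. l \<omega> = word_class V E w) = word_weight x w / ?Z"
  interpret prob_space M by fact
  fix n assume n: "n \<in> exponents V"
  let ?S = "{t \<in> traces V E. class_count t = n}"
  have prob_trace: "\<P>(\<omega> in M. l \<omega> = t) = (\<Prod>i\<in>V. x i ^ n i) * Delta V E x" if t: "t \<in> ?S" for t
  proof -
    obtain w where w: "w \<in> lists V" "t = word_class V E w"
      using t by (blast elim: traces_cases)
    have "\<P>(\<omega> in M. l \<omega> = t) = class_weight x t / ?Z"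
      using dist w by (simp add: class_weight_word_class)
    then show ?thesis
      using t class_weight_count[OF V, of t E x] Z by (simp flip: Z)
  qed
  have lT: "l \<omega> \<in> traces V E" if "\<omega> \<in> space M" for \<omega>
    using measurable_space[OF l that] by simp
  have "{\<omega> \<in> space M. class_count (l \<omega>) = n} = (\<Union>t\<in>?S. {\<omega> \<in> space M. l \<omega> = t})"
    using lT by auto
  then have "\<P>(\<omega> in M. class_count (l \<omega>) = n) = measure M (\<Union>t\<in>?S. {\<omega> \<in> space M. l \<omega> = t})"
    by simp
  also have "\<dots> = (\<Sum>t\<in>?S. \<P>(\<omega> in M. l \<omega> = t))"
  proof (rule finite_measure_finite_Union)
    show "finite ?S" by (rule finite_class_count_eq[OF V])
    have "{\<omega> \<in> space M. l \<omega> = t} \<in> sets M" if "t \<in> traces V E" for t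
    proof -
      have "{\<omega> \<in> space M. l \<omega> = t} = l -` {t} \<inter> space M" by auto
      then show ?thesis using measurable_sets[OF l, of "{t}"] that by simp
    qed
    then show "(\<lambda>t. {\<omega> \<in> space M. l \<omega> = t}) ` ?S \<subseteq> sets M" by blast
    show "disjoint_family_on (\<lambda>t. {\<omega> \<in> space M. l \<omega> = t}) ?S"
      by (auto simp: disjoint_family_on_def)
  qed
  also have "\<dots> = trace_number V E n * ((\<Prod>i\<in>V. x i ^ n i) * Delta V E x)"
    by (simp add: prob_trace trace_number_def)
  finally show "\<P>(\<omega> in M. class_count (l \<omega>) = n) =
      graph_multinomial V E n * (\<Prod>i\<in>V. x i ^ n i) * Delta V E x"
    by (simp add: graph_multinomial_eq_trace_number[OF V n] mult.assoc)
qed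

end
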